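(* For each $n = 1,2,\ldots$ let $f_n \colon [-1,1] \to [-1,1]$ be a piecewise-linear map with $f_n(0) = 0$. Assume that for each $n$ the restrictions of $f_n$ and of $f_n \circ f_{n+1}$ to each of $[-1,0]$ and $[0,1]$ are non-constant (so that their radial contour factors are defined). Suppose that for each $n$, the maps $f_n$ and $f_n \circ f_{n+1}$ have the same radial contour factor, i.e. $t_{f_n} = t_{f_n \circ f_{n+1}}$. Then there exists an embedding of $X = \varprojlim \langle [-1,1], f_n \rangle$ into $\mathbb{R}^2$ for which the point $\langle 0,0,\ldots \rangle \in X$ is accessible.
   Context: A map is a continuous function. A map $f \colon [-1,1] \to [-1,1]$ is piecewise-linear if there are finitely many points $-1 = c_0 < c_1 < \cdots < c_k = 1$ such that $f$ is linear (affine) on each $[c_{i-1},c_i]$ (similarly for other closed interval domains). Inverse limit: $\varprojlim \langle [-1,1], f_n \rangle = \{\langle x_1,x_2,\ldots\rangle \in \prod_{n\ge1}[-1,1] : f_n(x_{n+1}) = x_n \text{ for each } n \geq 1\}$, with the subspace topology from the product topology. Accessible: given an embedding $\Omega \colon X \to \mathbb{R}^2$, the point $x \in X$ is accessible (for $\Omega$) if there is an arc $A \subset \mathbb{R}^2$ (a homeomorphic copy of $[0,1]$) with $A \cap \Omega(X) = \{\Omega(x)\}$. Departures and contour points: let $f \colon [0,1] \to [-1,1]$ be a map with $f(0)=0$. A departure of $f$ is a number $x \in (0,1]$ such that $f(x) \notin f([0,x))$; it is positively oriented if $f(x)>0$ and negatively oriented if $f(x)<0$. A contour point of $f$ is a departure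 $\alpha$ such that for any departure $x$ of $f$ with $x > \alpha$ there exists a departure $y$ of $f$, of orientation opposite to that of $\alpha$, with $\alpha < y \leq x$. Contour factor: if $f \colon [0,1] \to [-1,1]$ is non-constant and piecewise-linear with $f(0)=0$, let $0 = \alpha_0 < \alpha_1 < \cdots < \alpha_n$ be $0$ together with all the contour points of $f$ (there are finitely many, and at least one). The contour factor $t_f \colon [0,1] \to [-1,1]$ is defined by $t_f(i/n) = f(\alpha_i)$ for $i = 0,\ldots,n$, and $t_f$ is linear in between these points. Radial contour factor: let $\mathsf{r} \colon [0,1] \to [-1,0]$, $\mathsf{r}(x) = -x$. If $f \colon [-1,1] \to [-1,1]$ is piecewise-linear with $f(0) = 0$ and $f|_{[-1,0]}$, $f|_{[0,1]}$ are both non-constant, the radial contour factor of $f$ is the piecewise-linear map $t_f \colon [-1,1] \to [-1,1]$ such that $t_f|_{[0,1]}$ is the contour factor of $f|_{[0,1]}$, and $t_f|_{[-1,0]} \circ \mathsf{r}$ is the contour factor of $f|_{[-1,0]} \circ \mathsf{r}$. *)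

theory Defs
  imports "HOL-Analysis.Analysis"
begin

text \<open>A map between real intervals is an HOL function \<open>real \<Rightarrow> real\<close> whose values outside the
  intended domain are irrelevant.\<close>

definition piecewise_linear_on :: "real \<Rightarrow> real \<Rightarrow> (real \<Rightarrow> real) \<Rightarrow> bool" where
  "piecewise_linear_on a b f \<longleftrightarrow>
     continuous_on {a..b} f \<and>
     (\<exists>(k::nat) (c::nat \<Rightarrow> real). c 0 = a \<and> c k = b \<and>
        (\<forall>i<k. c i < c (Suc i) \<and>
               (\<exists>m q. \<forall>x\<in>{c i..c (Suc i)}. f x = m * x + q)))"

text \<open>The topology on \<^typ>\<open>nat \<Rightarrow> real\<close> is the product topology. Sequences are indexed
  from \<open>0\<close>.\<close>

definition inverse_limit :: "real set \<Rightarrow> (nat \<Rightarrow> real \<Rightarrow> real) \<Rightarrow> (nat \<Rightarrow> real) set" where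
  "inverse_limit I f = {x. (\<forall>n. x n \<in> I) \<and> (\<forall>n. f n (x (Suc n)) = x n)}"

definition accessible ::
  "'a set \<Rightarrow> ('a \<Rightarrow> real ^ 2) \<Rightarrow> 'a \<Rightarrow> bool" where
  "accessible X \<Omega> x \<longleftrightarrow>
     x \<in> X \<and> (\<exists>A :: (real ^ 2) set. A homeomorphic {0..1::real} \<and> A \<inter> \<Omega> ` X = {\<Omega> x})"

definition departure :: "(real \<Rightarrow> real) \<Rightarrow> real \<Rightarrow> bool" where
  "departure f x \<longleftrightarrow> x \<in> {0<..1} \<and> f x \<notin> f ` {0..<x}"

definition positive_departure :: "(real \<Rightarrow> real) \<Rightarrow> real \<Rightarrow> bool" where
  "positive_departure f x \<longleftrightarrow> departure f x \<and> f x > 0"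

definition negative_departure :: "(real \<Rightarrow> real) \<Rightarrow> real \<Rightarrow> bool" where
  "negative_departure f x \<longleftrightarrow> departure f x \<and> f x < 0"

definition opposite_departures :: "(real \<Rightarrow> real) \<Rightarrow> real \<Rightarrow> real \<Rightarrow> bool" where
  "opposite_departures f x y \<longleftrightarrow>
     positive_departure f x \<and> negative_departure f y \<or>
     negative_departure f x \<and> positive_departure f y"

definition contour_point :: "(real \<Rightarrow> real) \<Rightarrow> real \<Rightarrow> bool" where
  "contour_point f \<alpha> \<longleftrightarrow>
     departure f \<alpha> \<and>
     (\<forall>x. departure f x \<and> x > \<alpha> \<longrightarrow> (\<exists>y. opposite_departures f \<alpha> y \<and> \<alpha> < y \<and> y \<le> x))"

text \<open>The increasing list \<open>[\<alpha>\<^sub>0, \<dots>, \<alpha>\<^sub>n]\<close>, with \<open>\<alpha>\<^sub>0 = 0\<close>. It is meaningful only when there are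
  finitely many contour points, as is the case for piecewise-linear \<open>f\<close>.\<close>

definition contour_list :: "(real \<Rightarrow> real) \<Rightarrow> real list" where
  "contour_list f = sorted_list_of_set (insert 0 {\<alpha>. contour_point f \<alpha>})"

text \<open>For \<open>x \<in> [0,1]\<close>, the point \<open>x\<close> lies in \<open>[i/n, (i+1)/n]\<close>, where \<open>i\<close> is \<open>\<lfloor>n x\<rfloor>\<close>, capped so that
  \<open>x = 1\<close> falls in the last interval; the value is the linear interpolation there
  (see \<open>contour_factor_segment\<close>).\<close>

definition contour_factor :: "(real \<Rightarrow> real) \<Rightarrow> real \<Rightarrow> real" where
  "contour_factor f x =
     (let n = length (contour_list f) - 1;
          i = min (nat \<lfloor>real n * x\<rfloor>) (n - 1)
      in linepath (f (contour_list f ! i)) (f (contour_list f ! Suc i)) (real n * x - real i))"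

lemma contour_factor_segment:
  assumes n: "n = length (contour_list f) - 1" and i: "i < n"
    and x: "x \<in> {real i / real n..real (Suc i) / real n}"
  shows "contour_factor f x =
    linepath (f (contour_list f ! i)) (f (contour_list f ! Suc i)) (real n * x - real i)"
proof -
  have np: "real n > 0" using i by simp
  have cf: "contour_factor f x =
      linepath (f (contour_list f ! min (nat \<lfloor>real n * x\<rfloor>) (n - 1)))
        (f (contour_list f ! Suc (min (nat \<lfloor>real n * x\<rfloor>) (n - 1))))
        (real n * x - real (min (nat \<lfloor>real n * x\<rfloor>) (n - 1)))"
    unfolding contour_factor_def Let_def n ..
  have lo: "real i \<le> real n * x" and hi: "real n * x \<le> real (Suc i)"
    using x np by (auto simp: field_simps)
  show ?thesis
  proof (cases "real n * x < real (Suc i)")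
    case True
    then have "\<lfloor>real n * x\<rfloor> = int i" using lo by (intro floor_unique) auto
    then have "min (nat \<lfloor>real n * x\<rfloor>) (n - 1) = i" using i by simp
    then show ?thesis unfolding cf by simp
  next
    case False
    then have eq: "real n * x = real (Suc i)" using hi by simp
    have fl: "nat \<lfloor>real n * x\<rfloor> = Suc i" unfolding eq floor_of_nat by simp
    show ?thesis
    proof (cases "Suc i < n")
      case True
      then have "min (nat \<lfloor>real n * x\<rfloor>) (n - 1) = Suc i" unfolding fl by simp
      then show ?thesis unfolding cf by (simp add: eq linepath_def)
    next
      case False
      then have "min (nat \<lfloor>real n * x\<rfloor>) (n - 1) = i" unfolding fl using i by simp
      then show ?thesis unfolding cf by simp
    qed
  qed
qed

lemma contour_factor_node:
  assumes n: "n = length (contour_list f) - 1" "0 < n" and i: "i \<le> n"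
  shows "contour_factor f (real i / real n) = f (contour_list f ! i)"
proof (cases "i < n")
  case True
  then show ?thesis
    using contour_factor_segment[OF n(1) True, of "real i / real n"]
    by (simp add: linepath_def divide_right_mono)
next
  case False
  then obtain j where j: "i = Suc j" "j < n" using n i by (cases i) auto
  then show ?thesis
    using contour_factor_segment[OF n(1) j(2), of "real i / real n"] n(2)
    by (simp add: linepath_def divide_right_mono)
qed

text \<open>On \<open>[-1,0]\<close>, the condition is that \<open>x \<mapsto> t\<^sub>f(-x)\<close> is the contour factor of \<open>x \<mapsto> f(-x)\<close>. Both
  branches give \<open>f 0\<close> at \<open>0\<close>.\<close>

definition radial_contour_factor :: "(real \<Rightarrow> real) \<Rightarrow> real \<Rightarrow> real" where
  "radial_contour_factor f x =
     (if 0 \<le> x then contour_factor f x else contour_factor (f \<circ> uminus) (- x))"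

end

(* Let t_n be the left half of the radial contour factor of f_n, folded onto [0,1]. Each f_n
   restricted to [-1,0] factors as t_n after a map S_n, and the hypothesis on f_n o f_{n+1} makes
   f_n o t_{n+1} factor as t_n after a map M_n. Replace the left half of each coordinate interval by
   the domain of t_n: the bonding maps then become g = theta_k o q_k, where q_n is f_n on the right
   and t_n on the left, and theta_k is nonpositive on the left half and agrees on the right half with
   theta_{k-1} o f. The inverse limit is unchanged.

   Say that g has an eps-violation if there are x <= 0 <= y such that the minimum of g on [0,y] is
   less than that on [x,0] minus eps, and the same holds for the maxima. For fixed n and eps only
   finitely many of the maps g into level n have one: a violation of the k-th map produces, for some
   grid values omega and eta, an arc on which theta_k rises to eta while staying above omega, whereas
   no such arc exists for theta_{k+1}; and such arcs for theta_{k+1} are mapped by f to such arcs for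
   theta_k.

   If g has no eps-violation, the two halves of g can be parametrised monotonically so that the right
   half always stays (up to 4 eps) to the right of the left half. Using the parameter as height, the
   graph of g is then perturbed to an arc, and indeed to the image of [-1,1] under an injective
   continuous map of the plane that fixes the half-line below the origin. Composing such maps in the
   manner of Anderson and Choquet, the limit embeds the inverse limit so that the segment from
   (0,0) to (0,-1) meets it only at the image of the zero sequence. *)

theory Submission
  imports Defs
begin

section \<open>Clamped coordinates\<close>

text \<open>A violation excludes every pairing of the two halves that keeps the right half to the
  right up to eps. The right half could reach its low point s only after the left half has passed x,
  and the left half its high point t only after the right half has passed y. Since s comes no later
  than y and t no later than x, each half would wait for the other. The discrete pairing shows that
  this deadlock is the only obstruction.

  The fold makes deadlocks rare: once theta is nonpositive on the left, a positive value can only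
  come from a positive argument, so f carries an arc from 0 on which theta_{k+1} rises over an arc
  from 0 in the right half.

  The tolerance eps is dictated by the uniform continuity of the planar map built so far, so the
  number of levels to skip cannot be fixed in advance; finiteness supplies a suitable k for whatever
  eps arises. The planar maps act on the whole plane because each one moves the arc off the axis,
  where the earlier ones must still be defined and injective.\<close>

definition clamp01 :: "real \<Rightarrow> real" where "clamp01 x = max 0 (min 1 x)"

lemma clamp01_simps [simp]: "x \<le> 0 \<Longrightarrow> clamp01 x = 0" "1 \<le> x \<Longrightarrow> clamp01 x = 1"
  "0 \<le> x \<Longrightarrow> x \<le> 1 \<Longrightarrow> clamp01 x = x"
  by (auto simp: clamp01_def)

lemma clamp01_bounds [simp]: "0 \<le> clamp01 x" "clamp01 x \<le> 1" "-1 \<le> clamp01 x" "- clamp01 x \<le> 1"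
  by (auto simp: clamp01_def)

lemma clamp01_mono: "x \<le> y \<Longrightarrow> clamp01 x \<le> clamp01 y"
  by (auto simp: clamp01_def)

lemma continuous_on_clamp01 [continuous_intros]:
  "continuous_on S f \<Longrightarrow> continuous_on S (\<lambda>x. clamp01 (f x))"
  unfolding clamp01_def by (intro continuous_intros)

text \<open>The sum interpolates the partial sums of \<open>d\<close> linearly between integers.
  Written with clamps it is continuous, and monotone for nonnegative \<open>d\<close>, without any
  choice of the current interval.\<close>

lemma sum_clamp01:
  fixes d :: "nat \<Rightarrow> real"
  assumes "k < n" "real k \<le> x" "x \<le> real (Suc k)"
  shows "(\<Sum>m<n. d m * clamp01 (x - real m)) = (\<Sum>m<k. d m) + d k * (x - real k)"
proof -
  have "(\<Sum>m<n. d m * clamp01 (x - real m)) = (\<Sum>m<Suc k. d m * clamp01 (x - real m))"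
    using assms by (intro sum.mono_neutral_right) (auto simp: not_less)
  also have "\<dots> = (\<Sum>m<k. d m * clamp01 (x - real m)) + d k * clamp01 (x - real k)" by simp
  also have "(\<Sum>m<k. d m * clamp01 (x - real m)) = (\<Sum>m<k. d m)"
    using assms by (intro sum.cong) auto
  finally show ?thesis using assms by simp
qed

section \<open>Monotone pairing of two functions\<close>

text \<open>The path advances greedily to the next record maximum of \<open>a\<close> or record minimum of \<open>b\<close>; if both
  moves are blocked, the blocking indices contradict \<open>nv\<close>.\<close>

lemma staircase_path:
  fixes a b :: "nat \<Rightarrow> real"
  assumes top: "\<And>i. i \<le> N \<Longrightarrow> a i \<le> a N" "\<And>j. j \<le> N \<Longrightarrow> b j \<le> a N"
    and bot: "\<And>j. j \<le> N \<Longrightarrow> b N \<le> b j" "\<And>i. i \<le> N \<Longrightarrow> b N \<le> a i"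
    and e: "0 \<le> e" and start: "b 0 - e \<le> a 0"
    and nv: "\<And>i j. i \<le> N \<Longrightarrow> j \<le> N \<Longrightarrow>
      \<not> ((\<forall>l\<le>j. a i < b l - e) \<and> (\<forall>l\<le>i. a l < b j - e))"
  shows "\<exists>n I J. I 0 = 0 \<and> J 0 = 0 \<and> I n = N \<and> J n = N \<and>
     (\<forall>m<n. I (Suc m) = Suc (I m) \<and> J (Suc m) = J m \<or> I (Suc m) = I m \<and> J (Suc m) = Suc (J m)) \<and>
     (\<forall>m\<le>n. b (J m) - e \<le> a (I m))"
proof -
  define R where "R = {((i,j),(i',j')). (i' = Suc i \<and> j' = j \<or> i' = i \<and> j' = Suc j) \<and> b j' - e \<le> a i'}"
  have right: "((i,j),(i',j)) \<in> R\<^sup>*" if "i \<le> i'" "\<And>l. i \<le> l \<Longrightarrow> l \<le> i' \<Longrightarrow> b j - e \<le> a l" for i i' j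
    using that
  proof (induction i' rule: dec_induct)
    case (step k)
    then have "((i,j),(k,j)) \<in> R\<^sup>*" by simp
    moreover have "((k,j),(Suc k,j)) \<in> R" using step by (simp add: R_def)
    ultimately show ?case by (rule rtrancl_into_rtrancl)
  qed simp
  have up: "((i,j),(i,j')) \<in> R\<^sup>*" if "j \<le> j'" "\<And>l. j \<le> l \<Longrightarrow> l \<le> j' \<Longrightarrow> b l - e \<le> a i" for i j j'
    using that
  proof (induction j' rule: dec_induct)
    case (step k)
    then have "((i,j),(i,k)) \<in> R\<^sup>*" by simp
    moreover have "((i,k),(i,Suc k)) \<in> R" using step by (simp add: R_def)
    ultimately show ?case by (rule rtrancl_into_rtrancl)
  qed simp
  \<comment> \<open>Only pairs of records are extended: \<open>a i\<close> is the largest value so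
    far and \<open>b j\<close> the smallest. A next record exists because \<open>a\<close> ends at
    its maximum and \<open>b\<close> at its minimum.\<close>
  have reach: "((i,j),(N,N)) \<in> R\<^sup>*"
    if "i \<le> N" "j \<le> N" "\<And>l. l \<le> i \<Longrightarrow> a l \<le> a i" "\<And>l. l \<le> j \<Longrightarrow> b j \<le> b l" "b j - e \<le> a i" for i j
    using that
  proof (induction "(N - i) + (N - j)" arbitrary: i j rule: less_induct)
    case less
    show ?case
    proof (cases "i = N \<or> j = N")
      case True
      then show ?thesis
      proof
        assume "i = N"
        then show ?thesis using up[of j N i] less.prems top(2) e by force
      next
        assume "j = N"
        then show ?thesis using right[of i N j] less.prems bot(2) e by force
      qed
    next
      case False
      then have lt: "i < N" "j < N" using less.prems by auto
      define i' where "i' = (LEAST l. i < l \<and> a i \<le> a l)"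
      define j' where "j' = (LEAST l. j < l \<and> b l \<le> b j)"
      have i': "i < i'" "a i \<le> a i'" "i' \<le> N"
        using LeastI[of "\<lambda>l. i < l \<and> a i \<le> a l" N] Least_le[of "\<lambda>l. i < l \<and> a i \<le> a l" N]
          lt top(1)[of i] unfolding i'_def by auto
      have j': "j < j'" "b j' \<le> b j" "j' \<le> N"
        using LeastI[of "\<lambda>l. j < l \<and> b l \<le> b j" N] Least_le[of "\<lambda>l. j < l \<and> b l \<le> b j" N]
          lt bot(1)[of j] unfolding j'_def by auto
      have ib: "a l < a i" if "i < l" "l < i'" for l
        using not_less_Least[of l "\<lambda>l. i < l \<and> a i \<le> a l"] that unfolding i'_def by force
      have jb: "b j < b l" if "j < l" "l < j'" for l
        using not_less_Least[of l "\<lambda>l. j < l \<and> b l \<le> b j"] that unfolding j'_def by force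
      have ia: "a l \<le> a i" if "l < i'" for l
        using ib[of l] less.prems(3)[of l] that by (cases "l \<le> i") auto
      have ja: "b j \<le> b l" if "l < j'" for l
        using jb[of l] less.prems(4)[of l] that by (cases "l \<le> j") auto
      consider "\<And>l. i \<le> l \<Longrightarrow> l \<le> i' \<Longrightarrow> b j - e \<le> a l"
        | "\<And>l. j \<le> l \<Longrightarrow> l \<le> j' \<Longrightarrow> b l - e \<le> a i"
        | l1 l2 where "i \<le> l1" "l1 \<le> i'" "a l1 < b j - e" "j \<le> l2" "l2 \<le> j'" "a i < b l2 - e"
        by (meson not_le)
      then show ?thesis
      proof cases
        case 1
        have "((i',j),(N,N)) \<in> R\<^sup>*"
        proof (rule less.hyps)
          show "N - i' + (N - j) < N - i + (N - j)" using i' lt by linarith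
          show "a l \<le> a i'" if "l \<le> i'" for l
            using ia[of l] i' that by (cases "l = i'") auto
          show "b j - e \<le> a i'" using 1[of i'] i' by simp
        qed (use i' less.prems in auto)
        then show ?thesis using right[of i i' j] 1 i' by (meson less_imp_le rtrancl_trans)
      next
        case 2
        have "((i,j'),(N,N)) \<in> R\<^sup>*"
        proof (rule less.hyps)
          show "N - i + (N - j') < N - i + (N - j)" using j' lt by linarith
          show "b j' \<le> b l" if "l \<le> j'" for l
            using ja[of l] j' that by (cases "l = j'") auto
          show "b j' - e \<le> a i" using 2[of j'] j' by simp
        qed (use j' less.prems in auto)
        then show ?thesis using up[of j j' i] 2 j' by (meson less_imp_le rtrancl_trans)
      next
        case 3
        have "l1 \<noteq> i'" "l2 \<noteq> j'" using 3 less.prems(5) i' j' by auto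
        then have l: "l1 < i'" "l2 < j'" using 3 by auto
        \<comment> \<open>Before \<open>i'\<close> the values of \<open>a\<close> do not exceed
          \<open>a i\<close>, and before \<open>j'\<close> those of \<open>b\<close> do not drop
          below \<open>b j\<close>, so the two local failures hold against all earlier indices as
          well.\<close>
        have "\<forall>l\<le>l2. a l1 < b l - e" using ja l 3 by (meson diff_right_mono le_less_trans less_le_trans)
        moreover have "\<forall>l\<le>l1. a l < b l2 - e" using ia l 3 by (meson le_less_trans)
        ultimately show ?thesis using nv[of l1 l2] l i' j' by auto
      qed
    qed
  qed
  have "((0,0),(N,N)) \<in> R\<^sup>*" by (rule reach) (use start in auto)
  then obtain n where "((0,0),(N,N)) \<in> R ^^ n" using rtrancl_imp_relpow by blast
  then obtain p where p: "p 0 = (0,0)" "p n = (N,N)" "\<forall>i<n. (p i, p (Suc i)) \<in> R"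
    by (auto simp: relpow_fun_conv)
  have good: "b (snd (p m)) - e \<le> a (fst (p m))" if "m \<le> n" for m
  proof (cases m)
    case 0
    then show ?thesis using p start by simp
  next
    case (Suc k)
    then show ?thesis using p(3)[rule_format, of k] that by (cases "p k"; cases "p (Suc k)") (auto simp: R_def)
  qed
  have st: "fst (p (Suc m)) = Suc (fst (p m)) \<and> snd (p (Suc m)) = snd (p m) \<or>
      fst (p (Suc m)) = fst (p m) \<and> snd (p (Suc m)) = Suc (snd (p m))" if "m < n" for m
    using p(3)[rule_format, OF that] by (cases "p m"; cases "p (Suc m)") (auto simp: R_def)
  show ?thesis
    by (rule exI[of _ n], rule exI[of _ "fst \<circ> p"], rule exI[of _ "snd \<circ> p"]) (use p good st in auto)
qed

text \<open>Sampling with mesh \<open>h\<close> reduces this to the staircase. The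
  \<open>4 * e\<close> consists of \<open>2 * e\<close> for the discrete path, whose violations lose
  one \<open>e\<close> when passing from the grid to all parameters, and one \<open>e\<close> each
  for returning from grid values to \<open>A\<close> and \<open>B\<close>. The domain reaches 3
  because the parametrisations overshoot 2 slightly.\<close>

lemma strict_mono_pairing:
  fixes A B :: "real \<Rightarrow> real"
  assumes cA: "continuous_on {0..3} A" and cB: "continuous_on {0..3} B"
    and topA: "\<And>s. 2 \<le> s \<Longrightarrow> A s = 2" and botB: "\<And>s. 2 \<le> s \<Longrightarrow> B s = -2"
    and bd: "\<And>s. 0 \<le> s \<Longrightarrow> \<bar>A s\<bar> \<le> 2 \<and> \<bar>B s\<bar> \<le> 2"
    and z: "A 0 = 0" "B 0 = 0" and e: "0 < e"
    and nv: "\<And>x y s t. \<lbrakk>0 \<le> s; s \<le> y; 0 \<le> t; t \<le> x; \<And>t'. 0 \<le> t' \<Longrightarrow> t' \<le> x \<Longrightarrow> A s < B t' - e;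
       \<And>s'. 0 \<le> s' \<Longrightarrow> s' \<le> y \<Longrightarrow> A s' < B t - e\<rbrakk> \<Longrightarrow> False"
  obtains r l c where "0 < c" "strict_mono r" "strict_mono l" "continuous_on UNIV r" "continuous_on UNIV l"
    "\<And>\<tau>. \<tau> \<le> 0 \<Longrightarrow> r \<tau> = c * \<tau> \<and> l \<tau> = c * \<tau>" "\<And>\<tau>. 0 \<le> \<tau> \<Longrightarrow> c * \<tau> \<le> r \<tau> \<and> c * \<tau> \<le> l \<tau>"
    "\<And>\<tau>. 0 \<le> \<tau> \<Longrightarrow> B (l \<tau>) - 4 * e \<le> A (r \<tau>)"
proof -
  have "uniformly_continuous_on {0..3} A" "uniformly_continuous_on {0..3} B"
    using cA cB compact_uniformly_continuous by blast+
  then obtain dA dB where dA: "dA > 0" "\<And>s t. \<lbrakk>0 \<le> s; s \<le> 3; 0 \<le> t; t \<le> 3; \<bar>s - t\<bar> < dA\<rbrakk> \<Longrightarrow> \<bar>A s - A t\<bar> < e"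
    and dB: "dB > 0" "\<And>s t. \<lbrakk>0 \<le> s; s \<le> 3; 0 \<le> t; t \<le> 3; \<bar>s - t\<bar> < dB\<rbrakk> \<Longrightarrow> \<bar>B s - B t\<bar> < e"
    unfolding uniformly_continuous_on_def dist_real_def using e by (metis atLeastAtMost_iff)
  define d where "d = min dA dB"
  have d: "d > 0" "\<And>s t. \<lbrakk>0 \<le> s; s \<le> 3; 0 \<le> t; t \<le> 3; \<bar>s - t\<bar> < d\<rbrakk> \<Longrightarrow> \<bar>A s - A t\<bar> < e \<and> \<bar>B s - B t\<bar> < e"
    unfolding d_def using dA dB by auto
  obtain N :: nat where N: "N > 2" "8 / d < real N"
    by (metis reals_Archimedean2 max_less_iff_conj of_nat_less_iff of_nat_numeral max.strict_coboundedI1 max.strict_coboundedI2 linorder_less_linear less_trans)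
  define h where "h = 2 / real N"
  have h: "0 < h" "3 * h < d" "real N * h = 2" "h \<le> 1"
    using N d unfolding h_def by (auto simp: field_simps)
  define a where "a = (\<lambda>i. A (real i * h))"
  define b where "b = (\<lambda>i. B (real i * h))"
  have pos: "0 \<le> real i * h" "real i * h \<le> 2" if "i \<le> N" for i
    using that h by (auto intro: order.trans[OF mult_right_mono, of _ "real N"])
  have grid: "\<exists>i\<le>j. \<bar>t - real i * h\<bar> \<le> h" if "0 \<le> t" "t \<le> real j * h" for t j
  proof -
    define i where "i = nat \<lfloor>t / h\<rfloor>"
    have "real i \<le> t / h" "t / h < real i + 1" unfolding i_def using that h by auto
    then have 1: "real i * h \<le> t" "t < real i * h + h" using h by (auto simp: field_simps)
    moreover have "i \<le> j"
    proof -
      have "real i * h \<le> real j * h" using 1 that by linarith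
      then show ?thesis using h by simp
    qed
    ultimately show ?thesis by (intro exI[of _ i]) auto
  qed
  have "\<exists>n I J. I 0 = 0 \<and> J 0 = 0 \<and> I n = N \<and> J n = N \<and>
     (\<forall>m<n. I (Suc m) = Suc (I m) \<and> J (Suc m) = J m \<or> I (Suc m) = I m \<and> J (Suc m) = Suc (J m)) \<and>
     (\<forall>m\<le>n. b (J m) - 2 * e \<le> a (I m))"
  proof (rule staircase_path)
    have "a N = 2" "b N = -2" unfolding a_def b_def using topA[of 2] botB[of 2] h by auto
    moreover have "\<bar>a i\<bar> \<le> 2 \<and> \<bar>b i\<bar> \<le> 2" if "i \<le> N" for i
      unfolding a_def b_def using bd pos[OF that] by blast
    ultimately show "a i \<le> a N" "b i \<le> a N" "b N \<le> b i" "b N \<le> a i" if "i \<le> N" for i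
      using that by (metis abs_le_iff minus_le_iff)+
    show "b 0 - 2 * e \<le> a 0" using z e by (simp add: a_def b_def)
    show "0 \<le> 2 * e" using e by simp
    show "\<not> ((\<forall>l\<le>j. a i < b l - 2 * e) \<and> (\<forall>l\<le>i. a l < b j - 2 * e))" if ij: "i \<le> N" "j \<le> N" for i j
    proof
      assume as: "(\<forall>l\<le>j. a i < b l - 2 * e) \<and> (\<forall>l\<le>i. a l < b j - 2 * e)"
      show False
      proof (rule nv[of "real i * h" "real i * h" "real j * h" "real j * h"])
        show "0 \<le> real i * h" "0 \<le> real j * h" using pos ij by auto
        fix t assume t: "0 \<le> t" "t \<le> real j * h"
        then obtain l where l: "l \<le> j" "\<bar>t - real l * h\<bar> \<le> h" using grid by blast
        then have "\<bar>B t - B (real l * h)\<bar> < e"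
          using d(2)[of t "real l * h"] pos[of l] pos[of j] t h ij by auto
        then show "A (real i * h) < B t - e" using as l unfolding a_def b_def by force
      next
        fix t assume t: "0 \<le> t" "t \<le> real i * h"
        then obtain l where l: "l \<le> i" "\<bar>t - real l * h\<bar> \<le> h" using grid by blast
        then have "\<bar>A t - A (real l * h)\<bar> < e"
          using d(2)[of t "real l * h"] pos[of l] pos[of i] t h ij by auto
        then show "A t < B (real j * h) - e" using as l unfolding a_def b_def by force
      qed auto
    qed
  qed
  then obtain n I J where IJ: "I 0 = 0" "J 0 = 0" "I n = N" "J n = N"
    and st: "\<And>m. m < n \<Longrightarrow> I (Suc m) = Suc (I m) \<and> J (Suc m) = J m \<or> I (Suc m) = I m \<and> J (Suc m) = Suc (J m)"
    and ab: "\<And>m. m \<le> n \<Longrightarrow> b (J m) - 2 * e \<le> a (I m)" by blast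
  have n0: "n > 0" using IJ N by (metis gr0I not_less_zero)
  \<comment> \<open>The staircase stands still in one coordinate at each step; a drift of slope
    \<open>c\<close> makes both parametrisations strictly increasing. Over the whole path it adds
    only \<open>h\<close>, so with one grid step the deviation from the grid is at most
    \<open>2 * h\<close>, which is below \<open>d\<close>.\<close>
  define c where "c = h / real n"
  have c: "c > 0" "c * real n = h" using h n0 by (auto simp: c_def)
  define W where "W = (\<lambda>(I::nat\<Rightarrow>nat) \<tau>. h * (\<Sum>m<n. (real (I (Suc m)) - real (I m)) * clamp01 (\<tau> - real m)) + c * \<tau>)"
  have sum0: "(\<Sum>m<k. real (I (Suc m)) - real (I m)) = real (I k) - real (I 0)" for I k
    by (induction k) auto
  have step: "m < n \<Longrightarrow> 0 \<le> real (I (Suc m)) - real (I m) \<and> real (I (Suc m)) - real (I m) \<le> 1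
      \<and> 0 \<le> real (J (Suc m)) - real (J m) \<and> real (J (Suc m)) - real (J m) \<le> 1" for m
    using st[of m] by auto
  have sumn: "(\<Sum>m<n. (real (I (Suc m)) - real (I m)) * clamp01 (\<tau> - real m)) = real (I n) - real (I 0)"
    if "real n \<le> \<tau>" for I \<tau>
    unfolding sum0[symmetric] using that by (intro sum.cong) auto
  have sm: "strict_mono (W K)"
    if K: "K 0 = 0" "K n = N" "\<And>m. m < n \<Longrightarrow> 0 \<le> real (K (Suc m)) - real (K m) \<and> real (K (Suc m)) - real (K m) \<le> 1" for K
    proof (rule strict_monoI)
      fix x y :: real assume "x < y"
      have "(\<Sum>m<n. (real (K (Suc m)) - real (K m)) * clamp01 (x - real m)) \<le> (\<Sum>m<n. (real (K (Suc m)) - real (K m)) * clamp01 (y - real m))"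
        using K \<open>x < y\<close> by (intro sum_mono mult_left_mono clamp01_mono) auto
      then have "h * (\<Sum>m<n. (real (K (Suc m)) - real (K m)) * clamp01 (x - real m)) \<le> h * (\<Sum>m<n. (real (K (Suc m)) - real (K m)) * clamp01 (y - real m))"
        using h by simp
      moreover have "c * x < c * y" using c \<open>x < y\<close> by simp
      ultimately show "W K x < W K y" unfolding W_def by linarith
    qed
  have gen: "strict_mono (W K) \<and> continuous_on UNIV (W K) \<and> (\<forall>\<tau>\<le>0. W K \<tau> = c * \<tau>) \<and> (\<forall>\<tau>\<ge>0. c * \<tau> \<le> W K \<tau>) \<and>
     (\<forall>m<n. \<forall>\<tau>. real m \<le> \<tau> \<and> \<tau> \<le> real (Suc m) \<longrightarrow> \<bar>W K \<tau> - real (K m) * h\<bar> \<le> 2 * h \<and> 0 \<le> W K \<tau> \<and> W K \<tau> \<le> 3) \<and>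
     (\<forall>\<tau>\<ge>real n. 2 \<le> W K \<tau>)"
    if K: "K 0 = 0" "K n = N" "\<And>m. m < n \<Longrightarrow> 0 \<le> real (K (Suc m)) - real (K m) \<and> real (K (Suc m)) - real (K m) \<le> 1" for K
  proof (intro conjI allI impI)
    show "strict_mono (W K)" by (rule sm[OF K])
    show "continuous_on UNIV (W K)" unfolding W_def by (intro continuous_intros)
    show "W K \<tau> = c * \<tau>" if "\<tau> \<le> 0" for \<tau> unfolding W_def using that by simp
    show "c * \<tau> \<le> W K \<tau>" if "0 \<le> \<tau>" for \<tau>
      unfolding W_def using K h by (auto intro!: sum_nonneg mult_nonneg_nonneg)
  next
    fix m \<tau> assume m: "m < n" "real m \<le> \<tau> \<and> \<tau> \<le> real (Suc m)"
    have "W K \<tau> = h * (real (K m) + (real (K (Suc m)) - real (K m)) * (\<tau> - real m)) + c * \<tau>"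
      unfolding W_def using sum_clamp01[of m n \<tau>] m K by (simp add: sum0)
    then have eq: "W K \<tau> - real (K m) * h = h * ((real (K (Suc m)) - real (K m)) * (\<tau> - real m)) + c * \<tau>"
      by (simp add: algebra_simps)
    have "0 \<le> (real (K (Suc m)) - real (K m)) * (\<tau> - real m)" "(real (K (Suc m)) - real (K m)) * (\<tau> - real m) \<le> 1"
      using K(3)[OF m(1)] m by (auto intro!: mult_nonneg_nonneg mult_le_one)
    then have "0 \<le> h * ((real (K (Suc m)) - real (K m)) * (\<tau> - real m))" "h * ((real (K (Suc m)) - real (K m)) * (\<tau> - real m)) \<le> h * 1"
      using h by (auto simp del: mult_1_right)
    moreover have "c * \<tau> \<le> c * real n" "0 \<le> c * \<tau>" using m c by (auto intro!: mult_left_mono)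
    ultimately have w: "0 \<le> W K \<tau> - real (K m) * h" "W K \<tau> - real (K m) * h \<le> 2 * h"
      using eq c by auto
    then show "\<bar>W K \<tau> - real (K m) * h\<bar> \<le> 2 * h" by simp
    have "0 \<le> real (K m) * h" using h by simp
    then show "0 \<le> W K \<tau>" using w by linarith
    have "W K \<tau> \<le> W K (real n)" using sm[OF K] m by (auto simp: strict_mono_less_eq)
    also have "W K (real n) = h * real (K n) + c * real n"
      unfolding W_def using K sumn[of "real n" K] by simp
    also have "\<dots> \<le> 3" using K c h by (simp add: mult.commute)
    finally show "W K \<tau> \<le> 3" .
  next
    fix \<tau> assume "real n \<le> \<tau>"
    then have "W K \<tau> = h * real (K n) + c * \<tau>"
      unfolding W_def using K sumn[OF \<open>real n \<le> \<tau>\<close>, of K] by simp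
    moreover have "0 \<le> c * \<tau>" using c \<open>real n \<le> \<tau>\<close> by auto
    ultimately show "2 \<le> W K \<tau>" using K h by (simp add: mult.commute)
  qed
  have gI: "strict_mono (W I)" "continuous_on UNIV (W I)" "\<And>\<tau>. \<tau>\<le>0 \<Longrightarrow> W I \<tau> = c * \<tau>" "\<And>\<tau>. \<tau>\<ge>0 \<Longrightarrow> c * \<tau> \<le> W I \<tau>"
     "\<And>m \<tau>. \<lbrakk>m<n; real m \<le> \<tau>; \<tau> \<le> real (Suc m)\<rbrakk> \<Longrightarrow> \<bar>W I \<tau> - real (I m) * h\<bar> \<le> 2 * h \<and> 0 \<le> W I \<tau> \<and> W I \<tau> \<le> 3"
     "\<And>\<tau>. real n \<le> \<tau> \<Longrightarrow> 2 \<le> W I \<tau>" using gen[of I, OF IJ(1,3)] step by blast+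
  have gJ: "strict_mono (W J)" "continuous_on UNIV (W J)" "\<And>\<tau>. \<tau>\<le>0 \<Longrightarrow> W J \<tau> = c * \<tau>" "\<And>\<tau>. \<tau>\<ge>0 \<Longrightarrow> c * \<tau> \<le> W J \<tau>"
     "\<And>m \<tau>. \<lbrakk>m<n; real m \<le> \<tau>; \<tau> \<le> real (Suc m)\<rbrakk> \<Longrightarrow> \<bar>W J \<tau> - real (J m) * h\<bar> \<le> 2 * h \<and> 0 \<le> W J \<tau> \<and> W J \<tau> \<le> 3"
     "\<And>\<tau>. real n \<le> \<tau> \<Longrightarrow> 2 \<le> W J \<tau>" using gen[of J, OF IJ(2,4)] step by blast+
  have mono: "I m \<le> N \<and> J m \<le> N" if "m \<le> n" for m
  proof -
    have "I m \<le> I n \<and> J m \<le> J n" using that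
    proof (induction m rule: inc_induct)
      case (step k)
      then show ?case using st[of k] by auto
    qed simp
    then show ?thesis using IJ by simp
  qed
  show thesis
  proof (rule that[of c "W I" "W J"])
    fix \<tau> :: real assume t: "0 \<le> \<tau>"
    show "B (W J \<tau>) - 4 * e \<le> A (W I \<tau>)"
    proof (cases "\<tau> < real n")
      case False
      then have "2 \<le> W I \<tau>" "2 \<le> W J \<tau>" using gI(6) gJ(6) by auto
      then show ?thesis using topA botB e by simp
    next
      case True
      define m where "m = nat \<lfloor>\<tau>\<rfloor>"
      have m: "real m \<le> \<tau>" "\<tau> \<le> real (Suc m)" "m < n"
        unfolding m_def using t True by linarith+
      have i: "\<bar>W I \<tau> - real (I m) * h\<bar> \<le> 2 * h" "0 \<le> W I \<tau>" "W I \<tau> \<le> 3"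
        and j: "\<bar>W J \<tau> - real (J m) * h\<bar> \<le> 2 * h" "0 \<le> W J \<tau>" "W J \<tau> \<le> 3"
        using gI(5)[OF m(3,1,2)] gJ(5)[OF m(3,1,2)] by auto
      have "\<bar>A (W I \<tau>) - A (real (I m) * h)\<bar> < e"
        using d(2)[of "W I \<tau>" "real (I m) * h"] i pos[of "I m"] mono[of m] m h by auto
      moreover have "\<bar>B (W J \<tau>) - B (real (J m) * h)\<bar> < e"
        using d(2)[of "W J \<tau>" "real (J m) * h"] j pos[of "J m"] mono[of m] m h by auto
      ultimately show ?thesis using ab[of m] m unfolding a_def b_def by linarith
    qed
  qed (use c gI gJ in auto)
qed

section \<open>Injective planar maps close to an interval map\<close>

lemma strict_mono_homeo:
  fixes r :: "real \<Rightarrow> real"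
  assumes r: "strict_mono r" "continuous_on UNIV r" and c: "0 < c"
    and lo: "\<And>\<tau>. \<tau> \<le> 0 \<Longrightarrow> r \<tau> = c * \<tau>" and hi: "\<And>\<tau>. 0 \<le> \<tau> \<Longrightarrow> c * \<tau> \<le> r \<tau>"
  shows "continuous_on UNIV (inv r)" "\<And>x. r (inv r x) = x" "\<And>\<tau>. inv r (r \<tau>) = \<tau>"
    "\<And>x. 0 \<le> x \<Longrightarrow> 0 \<le> inv r x \<and> c * inv r x \<le> x"
proof -
  have inj: "inj r" using r(1) by (rule strict_mono_imp_inj_on)
  have surj: "surj r"
    unfolding surj_def
  proof
    fix y :: real
    have "\<exists>x\<ge>min 0 (y / c). x \<le> max 0 (y / c) \<and> r x = y"
    proof (rule IVT')
      show "r (min 0 (y / c)) \<le> y" using lo[of "min 0 (y / c)"] c by (auto simp: min_def field_simps)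
      show "y \<le> r (max 0 (y / c))" using hi[of "max 0 (y / c)"] c by (auto simp: max_def field_simps)
      show "min 0 (y / c) \<le> max 0 (y / c)" by simp
      show "continuous_on {min 0 (y / c)..max 0 (y / c)} r" using r(2) continuous_on_subset by blast
    qed
    then show "\<exists>x. y = r x" by blast
  qed
  show ri: "r (inv r x) = x" for x using surj by (simp add: surj_f_inv_f)
  show ir: "inv r (r \<tau>) = \<tau>" for \<tau> using inj by simp
  have less: "inv r x \<le> inv r y" if "x \<le> y" for x y
    using that strict_mono_less_eq[OF r(1), of "inv r x" "inv r y"] by (simp add: ri)
  have "range (inv r) = UNIV" using inj by (rule inj_imp_surj_inv)
  then show "continuous_on UNIV (inv r)" using less by (intro continuous_onI_mono) auto
  show "0 \<le> inv r x \<and> c * inv r x \<le> x" if "0 \<le> x" for x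
  proof -
    have "inv r 0 = 0" using ir[of 0] lo[of 0] by simp
    then have "0 \<le> inv r x" using less[OF that] by simp
    then show ?thesis using hi[of "inv r x"] by (simp add: ri)
  qed
qed

text \<open>\<open>H\<close> lifts the point \<open>(x,y)\<close> to the height \<open>y + \<delta> T x\<close>, where \<open>T x\<close> is the parameter of \<open>x\<close> in the monotone
  pairing, and on the line of height \<open>\<delta> \<tau>\<close> it stretches \<open>[- l \<tau>, r \<tau>]\<close> affinely onto \<open>[G \<tau>, F \<tau>]\<close>,
  translating outside this interval.\<close>

lemma planar_step:
  fixes g :: "real \<Rightarrow> real"
  assumes cg: "continuous_on {-1..1} g" and gr: "g \<in> {-1..1} \<rightarrow> {-1..1}" and g0: "g 0 = 0" and e: "0 < e"
    and nv: "\<And>x y s t. \<lbrakk>-1 \<le> x; x \<le> t; t \<le> 0; 0 \<le> s; s \<le> y; y \<le> 1;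
       \<And>t'. x \<le> t' \<Longrightarrow> t' \<le> 0 \<Longrightarrow> g s < g t' - e; \<And>s'. 0 \<le> s' \<Longrightarrow> s' \<le> y \<Longrightarrow> g s' < g t - e\<rbrakk> \<Longrightarrow> False"
  obtains H :: "real \<times> real \<Rightarrow> real \<times> real" where "continuous_on UNIV H" "inj H"
    "\<And>s. 0 \<le> s \<Longrightarrow> H (0, - s) = (0, - s)" "\<And>x. \<bar>x\<bar> \<le> 1 \<Longrightarrow> dist (H (x, 0)) (g x, 0) \<le> 6 * e"
proof -
  \<comment> \<open>Beyond the end of the arc the right half is continued upwards to 2 and the left
    half downwards to -2. Both then end at the extreme values that the pairing requires, and a
    violation by the extensions restricts to one by \<open>g\<close>.\<close>
  define A where "A = (\<lambda>s. g (clamp01 s) + (2 - g 1) * clamp01 (s - 1))"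
  define B where "B = (\<lambda>s. g (- clamp01 s) - (2 + g (-1)) * clamp01 (s - 1))"
  have gb: "\<bar>g x\<bar> \<le> 1" if "\<bar>x\<bar> \<le> 1" for x using gr that by (auto simp: abs_le_iff Pi_iff)
  have cA: "continuous_on UNIV A" and cB: "continuous_on UNIV B"
    unfolding A_def B_def
    by (intro continuous_intros continuous_on_compose2[OF cg]; auto)+
  have A1: "A s = g s" and B1: "B s = g (- s)" if "0 \<le> s" "s \<le> 1" for s
    using that by (auto simp: A_def B_def)
  have A2: "g 1 \<le> A s" "A s \<le> 2" and B2: "B s \<le> g (-1)" "-2 \<le> B s" if "1 \<le> s" for s
  proof -
    have k: "0 \<le> clamp01 (s - 1)" "clamp01 (s - 1) \<le> 1" by auto
    have 1: "\<bar>g 1\<bar> \<le> 1" "\<bar>g (-1)\<bar> \<le> 1" using gb by auto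
    have "0 \<le> (2 - g 1) * clamp01 (s - 1)" "0 \<le> (2 + g (-1)) * clamp01 (s - 1)"
      using k 1 by (auto intro!: mult_nonneg_nonneg)
    moreover have "(2 - g 1) * clamp01 (s - 1) \<le> (2 - g 1) * 1" "(2 + g (-1)) * clamp01 (s - 1) \<le> (2 + g (-1)) * 1"
      using k 1 by (intro mult_left_mono; linarith)+
    ultimately show "g 1 \<le> A s" "A s \<le> 2" "B s \<le> g (-1)" "-2 \<le> B s"
      using that by (auto simp: A_def B_def)
  qed
  have bd: "\<bar>A s\<bar> \<le> 2 \<and> \<bar>B s\<bar> \<le> 2" if "0 \<le> s" for s
    using A1[of s] B1[of s] A2[of s] B2[of s] gb[of s] gb[of "-s"] gb[of 1] gb[of "-1"] that
    by (cases "s \<le> 1") auto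
  have AB0: "A 0 = 0" "B 0 = 0" using A1[of 0] B1[of 0] g0 by auto
  obtain r l c where c: "0 < c" and sm: "strict_mono r" "strict_mono l"
    and cont: "continuous_on UNIV r" "continuous_on UNIV l"
    and neg: "\<And>\<tau>. \<tau> \<le> 0 \<Longrightarrow> r \<tau> = c * \<tau> \<and> l \<tau> = c * \<tau>"
    and pos: "\<And>\<tau>. 0 \<le> \<tau> \<Longrightarrow> c * \<tau> \<le> r \<tau> \<and> c * \<tau> \<le> l \<tau>"
    and AB: "\<And>\<tau>. 0 \<le> \<tau> \<Longrightarrow> B (l \<tau>) - 4 * e \<le> A (r \<tau>)"
  proof (rule strict_mono_pairing[of A B e])
    show "continuous_on {0..3} A" "continuous_on {0..3} B" using cA cB continuous_on_subset by blast+
    show "A s = 2" "B s = -2" if "2 \<le> s" for s using that by (auto simp: A_def B_def)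
    show "\<And>s. 0 \<le> s \<Longrightarrow> \<bar>A s\<bar> \<le> 2 \<and> \<bar>B s\<bar> \<le> 2" by (rule bd)
    show "A 0 = 0" "B 0 = 0" "0 < e" using AB0 e by auto
  next
    fix x y s t
    assume h: "0 \<le> s" "s \<le> y" "0 \<le> t" "t \<le> x" and 1: "\<And>t'. 0 \<le> t' \<Longrightarrow> t' \<le> x \<Longrightarrow> A s < B t' - e"
      and 2: "\<And>s'. 0 \<le> s' \<Longrightarrow> s' \<le> y \<Longrightarrow> A s' < B t - e"
    have s: "g (min s 1) \<le> A s" using A2[of s] A1[of s] h by (auto simp: min_def)
    have t: "B t \<le> g (- min t 1)" using B2[of t] B1[of t] h by (auto simp: min_def)
    show False
    proof (rule nv[of "- min x 1" "- min t 1" "min s 1" "min y 1"])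
      fix t' assume "- min x 1 \<le> t'" "t' \<le> 0"
      then show "g (min s 1) < g t' - e" using 1[of "- t'"] B1[of "- t'"] s by (auto simp: min_def split: if_splits)
    next
      fix s' assume "0 \<le> s'" "s' \<le> min y 1"
      then show "g s' < g (- min t 1) - e" using 2[of s'] A1[of s'] t by (auto simp: min_def split: if_splits)
    qed (use h in auto)
  qed (rule that, assumption+)
  note inr = strict_mono_homeo[OF sm(1) cont(1) c, of, OF conjunct1[OF neg] conjunct1[OF pos]]
  note inl = strict_mono_homeo[OF sm(2) cont(2) c, of, OF conjunct2[OF neg] conjunct2[OF pos]]
  have r0: "r 0 = 0" "l 0 = 0" using neg[of 0] by auto
  have rp: "0 < r \<tau>" "0 < l \<tau>" if "0 < \<tau>" for \<tau>
    using pos[of \<tau>] c that by (auto intro: less_le_trans[of 0 "c * \<tau>"])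
  have "\<exists>d>0. \<forall>\<tau>. \<bar>\<tau>\<bar> < d \<longrightarrow> \<bar>A (r \<tau>)\<bar> < e \<and> \<bar>B (l \<tau>)\<bar> < e \<and> \<bar>r \<tau>\<bar> < e \<and> \<bar>l \<tau>\<bar> < e"
  proof -
    have "continuous_on UNIV (\<lambda>\<tau>. \<bar>A (r \<tau>)\<bar> + \<bar>B (l \<tau>)\<bar> + \<bar>r \<tau>\<bar> + \<bar>l \<tau>\<bar>)"
      by (intro continuous_intros continuous_on_compose2[OF cA] continuous_on_compose2[OF cB] cont) auto
    then obtain d where "d > 0" "\<And>\<tau>. \<bar>\<tau>\<bar> < d \<Longrightarrow> \<bar>(\<bar>A (r \<tau>)\<bar> + \<bar>B (l \<tau>)\<bar> + \<bar>r \<tau>\<bar> + \<bar>l \<tau>\<bar>) - 0\<bar> < e"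
      using e AB0 r0 unfolding continuous_on_iff dist_real_def
      by (metis (no_types, lifting) UNIV_I abs_zero add.right_neutral diff_zero)
    then show ?thesis by (intro exI[of _ d]) (smt (verit))
  qed
  then obtain d where d: "d > 0"
    "\<And>\<tau>. \<bar>\<tau>\<bar> < d \<Longrightarrow> \<bar>A (r \<tau>)\<bar> < e \<and> \<bar>B (l \<tau>)\<bar> < e \<and> \<bar>r \<tau>\<bar> < e \<and> \<bar>l \<tau>\<bar> < e" by blast
  \<comment> \<open>On \<open>[\<tau>1, 2 * \<tau>1]\<close> the pair \<open>(- l, r)\<close> is
    blended into the shifted values of \<open>B\<close> and \<open>A\<close>; as
    \<open>2 * \<tau>1 < d\<close>, all these functions are still below \<open>e\<close> there. Up
    to \<open>\<tau>1\<close> nothing is bent, which keeps the half-line fixed.\<close>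
  define \<tau>1 where "\<tau>1 = d / 3"
  have t1: "0 < \<tau>1" using d by (simp add: \<tau>1_def)
  define ch where "ch = (\<lambda>\<tau>. clamp01 ((\<tau> - \<tau>1) / \<tau>1))"
  \<comment> \<open>Since \<open>B (l \<tau>) - 4 * e \<le> A (r \<tau>)\<close>, shifting both ends
    outwards by \<open>3 * e\<close> leaves a gap of at least \<open>2 * e\<close>.\<close>
  define F where "F = (\<lambda>\<tau>. (1 - ch \<tau>) * r \<tau> + ch \<tau> * (A (r \<tau>) + 3 * e))"
  define G where "G = (\<lambda>\<tau>. - (1 - ch \<tau>) * l \<tau> + ch \<tau> * (B (l \<tau>) - 3 * e))"
  have chi: "0 \<le> ch \<tau>" "ch \<tau> \<le> 1" for \<tau> by (auto simp: ch_def)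
  have chi0: "ch \<tau> = 0" if "\<tau> \<le> \<tau>1" for \<tau>
    unfolding ch_def using that t1 by (intro clamp01_simps) (auto simp: field_simps)
  have chi1: "ch \<tau> = 1" if "2 * \<tau>1 \<le> \<tau>" for \<tau>
    unfolding ch_def using that t1 by (intro clamp01_simps) (auto simp: field_simps)
  have GF: "G \<tau> < F \<tau>" if "0 < \<tau>" for \<tau>
  proof -
    have eq: "F \<tau> - G \<tau> = (1 - ch \<tau>) * (r \<tau> + l \<tau>) + ch \<tau> * (A (r \<tau>) - B (l \<tau>) + 6 * e)"
      by (simp add: F_def G_def algebra_simps)
    have p: "0 < r \<tau> + l \<tau>" "0 < A (r \<tau>) - B (l \<tau>) + 6 * e" using rp[OF that] AB[of \<tau>] that e by auto
    have "0 < (1 - ch \<tau>) * (r \<tau> + l \<tau>) + ch \<tau> * (A (r \<tau>) - B (l \<tau>) + 6 * e)"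
    proof (cases "ch \<tau> = 0")
      case False
      then have "0 < ch \<tau> * (A (r \<tau>) - B (l \<tau>) + 6 * e)" using chi[of \<tau>] p by auto
      moreover have "0 \<le> (1 - ch \<tau>) * (r \<tau> + l \<tau>)" using chi[of \<tau>] p by auto
      ultimately show ?thesis by linarith
    qed (use p in simp)
    then show ?thesis using eq by linarith
  qed
  have cF: "continuous_on UNIV F" and cG: "continuous_on UNIV G"
    unfolding F_def G_def ch_def using t1
    by (intro continuous_intros continuous_on_compose2[OF cA] continuous_on_compose2[OF cB] cont; auto)+
  define C where "C = (\<lambda>(\<tau>,x). max (- l \<tau>) (min (r \<tau>) x))"
  define K where "K = (\<lambda>\<tau>. (F \<tau> - G \<tau>) / (r \<tau> + l \<tau>))"
  define bend where "bend = (\<lambda>p. if fst p \<le> \<tau>1 then snd p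
    else G (fst p) + (snd p - C p) + K (fst p) * (C p + l (fst p)))"
  have low: "G \<tau> = - l \<tau> \<and> F \<tau> = r \<tau>" if "\<tau> \<le> \<tau>1" for \<tau>
    using chi0[OF that] by (simp add: F_def G_def)
  have cb: "continuous_on UNIV bend"
  proof -
    have "continuous_on ({p. fst p \<le> \<tau>1} \<union> {p. \<tau>1 \<le> fst p}) bend"
      unfolding bend_def
    proof (rule continuous_on_cases)
      show "closed {p::real\<times>real. fst p \<le> \<tau>1}" "closed {p::real\<times>real. \<tau>1 \<le> fst p}"
        by (intro closed_Collect_le continuous_intros)+
      show "continuous_on {p. fst p \<le> \<tau>1} (snd :: real\<times>real \<Rightarrow> real)" by (intro continuous_intros)
      have ne: "r (fst p) + l (fst p) \<noteq> 0" if "p \<in> {p::real\<times>real. \<tau>1 \<le> fst p}" for p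
        using rp[of "fst p"] that t1 by auto
      show "continuous_on {p. \<tau>1 \<le> fst p} (\<lambda>p. G (fst p) + (snd p - C p) + K (fst p) * (C p + l (fst p)))"
        unfolding C_def K_def case_prod_beta
        by (intro continuous_intros continuous_on_compose2[OF cF] continuous_on_compose2[OF cG]
            continuous_on_compose2[OF cont(1)] continuous_on_compose2[OF cont(2)]) (use ne in auto)
      show "\<forall>x. x \<in> {p. fst p \<le> \<tau>1} \<and> \<not> fst x \<le> \<tau>1 \<or> x \<in> {p. \<tau>1 \<le> fst p} \<and> fst x \<le> \<tau>1 \<longrightarrow>
        snd x = G (fst x) + (snd x - C x) + K (fst x) * (C x + l (fst x))"
      proof (intro allI impI)
        fix x :: "real \<times> real"
        assume "x \<in> {p. fst p \<le> \<tau>1} \<and> \<not> fst x \<le> \<tau>1 \<or> x \<in> {p. \<tau>1 \<le> fst p} \<and> fst x \<le> \<tau>1"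
        then have "fst x = \<tau>1" by auto
        moreover have "K \<tau>1 = 1" using low[of \<tau>1] rp[OF t1] unfolding K_def by simp
        ultimately show "snd x = G (fst x) + (snd x - C x) + K (fst x) * (C x + l (fst x))"
          using low[of \<tau>1] by simp
      qed
    qed
    moreover have "{p. fst p \<le> \<tau>1} \<union> {p::real\<times>real. \<tau>1 \<le> fst p} = UNIV" by auto
    ultimately show ?thesis by simp
  qed
  have bsm: "bend (\<tau>, x) < bend (\<tau>, y)" if "x < y" for \<tau> x y
  proof (cases "\<tau> \<le> \<tau>1")
    case False
    then have "0 < \<tau>" using t1 by simp
    then have K: "0 < K \<tau>" unfolding K_def using GF[of \<tau>] rp[of \<tau>] by auto
    have "C (\<tau>, x) \<le> C (\<tau>, y)" "C (\<tau>, y) - C (\<tau>, x) \<le> y - x"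
      unfolding C_def using that by (auto simp: max_def min_def)
    moreover have "K \<tau> * C (\<tau>, x) < K \<tau> * C (\<tau>, y) \<or> C (\<tau>, x) = C (\<tau>, y)"
      using K calculation(1) by auto
    ultimately show ?thesis using that False by (auto simp: bend_def distrib_left)
  qed (use that in \<open>simp add: bend_def\<close>)
  \<comment> \<open>One summand always vanishes: \<open>x = r (T x)\<close> on the right half and
    \<open>x = - l (T x)\<close> on the left half.\<close>
  define T where "T = (\<lambda>x. inv r (max x 0) + inv l (max (- x) 0))"
  have cT: "continuous_on UNIV T"
    unfolding T_def by (intro continuous_intros continuous_on_compose2[OF inr(1)] continuous_on_compose2[OF inl(1)]) auto
  have i0: "inv r 0 = 0" "inv l 0 = 0" using inr(3)[of 0] inl(3)[of 0] r0 by auto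
  \<comment> \<open>On the arc \<open>c * T x \<le> 1\<close>, so the height is at most
    \<open>e\<close>. This is the last \<open>e\<close> of the bound \<open>6 * e\<close>; the other
    \<open>5 * e\<close> are horizontal.\<close>
  define \<delta> where "\<delta> = e * c"
  have dl: "0 < \<delta>" using e c by (simp add: \<delta>_def)
  \<comment> \<open>A vertical shear followed by a map that is strictly increasing on each
    horizontal line, hence injective.\<close>
  define H where "H = (\<lambda>p. (bend ((snd p + \<delta> * T (fst p)) / \<delta>, fst p), snd p + \<delta> * T (fst p)))"
  show thesis
  proof (rule that[of H])
    show "continuous_on UNIV H"
      unfolding H_def using dl
      by (intro continuous_intros continuous_on_compose2[OF cb] continuous_on_compose2[OF cT]) auto
    show "inj H"
    proof (rule injI)
      fix p q assume "H p = H q"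
      then have v: "snd p + \<delta> * T (fst p) = snd q + \<delta> * T (fst q)"
        and b: "bend ((snd p + \<delta> * T (fst p)) / \<delta>, fst p) = bend ((snd p + \<delta> * T (fst p)) / \<delta>, fst q)"
        by (auto simp: H_def)
      then have "fst p = fst q" using bsm by (metis less_irrefl linorder_less_linear)
      then show "p = q" using v by (simp add: prod_eq_iff)
    qed
    show "H (0, - s) = (0, - s)" if "0 \<le> s" for s
    proof -
      have "- s / \<delta> \<le> \<tau>1" using that dl t1 by (auto intro: order.trans[of _ 0])
      then show ?thesis by (simp add: H_def T_def i0 bend_def)
    qed
  next
    fix x :: real assume x: "\<bar>x\<bar> \<le> 1"
    have fin: "dist (H (x, 0)) (g x, 0) \<le> 6 * e"
      if "\<bar>bend (T x, x) - g x\<bar> \<le> 5 * e" "0 \<le> T x" "c * T x \<le> 1"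
    proof -
      have "0 \<le> \<delta> * T x" using that dl by simp
      moreover have "e * (c * T x) \<le> e * 1" using that e by (intro mult_left_mono; linarith)
      then have "\<delta> * T x \<le> e" by (simp add: \<delta>_def mult.assoc)
      moreover have "H (x, 0) = (bend (T x, x), \<delta> * T x)" using dl by (simp add: H_def)
      moreover have "dist (bend (T x, x), \<delta> * T x) (g x, 0) \<le> \<bar>bend (T x, x) - g x\<bar> + \<bar>\<delta> * T x\<bar>"
        unfolding dist_Pair_Pair dist_real_def using sqrt_sum_squares_le_sum_abs[of "bend (T x, x) - g x" "\<delta> * T x"] by simp
      ultimately show ?thesis using that by auto
    qed
    have near: "\<bar>((1 - k) * u + k * (w + z)) - w\<bar> \<le> \<bar>u\<bar> + \<bar>w\<bar> + \<bar>z\<bar>" if "0 \<le> k" "k \<le> 1" for k u w z :: real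
    proof -
      have "((1 - k) * u + k * (w + z)) - w = (1 - k) * u + k * z - (1 - k) * w" by (simp add: algebra_simps)
      moreover have "\<bar>(1 - k) * u\<bar> \<le> 1 * \<bar>u\<bar>" "\<bar>(1 - k) * w\<bar> \<le> 1 * \<bar>w\<bar>" "\<bar>k * z\<bar> \<le> 1 * \<bar>z\<bar>"
        unfolding abs_mult using that by (intro mult_right_mono; simp)+
      ultimately show ?thesis by linarith
    qed
    have Fn: "\<bar>F \<tau> - A (r \<tau>)\<bar> \<le> 5 * e" "\<bar>G \<tau> - B (l \<tau>)\<bar> \<le> 5 * e" if "0 \<le> \<tau>" for \<tau>
    proof -
      show "\<bar>F \<tau> - A (r \<tau>)\<bar> \<le> 5 * e"
      proof (cases "\<tau> \<le> 2 * \<tau>1")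
        case True
        then have "\<bar>\<tau>\<bar> < d" using that d t1 by (simp add: \<tau>1_def)
        then show ?thesis using near[of "ch \<tau>" "r \<tau>" "A (r \<tau>)" "3 * e"] chi[of \<tau>] d(2)[of \<tau>] e unfolding F_def by linarith
      qed (use chi1[of \<tau>] e in \<open>simp add: F_def\<close>)
      show "\<bar>G \<tau> - B (l \<tau>)\<bar> \<le> 5 * e"
      proof (cases "\<tau> \<le> 2 * \<tau>1")
        case True
        then have "\<bar>\<tau>\<bar> < d" using that d t1 by (simp add: \<tau>1_def)
        moreover have "G \<tau> = (1 - ch \<tau>) * (- l \<tau>) + ch \<tau> * (B (l \<tau>) + (- 3 * e))" by (simp add: G_def algebra_simps)
        ultimately show ?thesis using near[of "ch \<tau>" "- l \<tau>" "B (l \<tau>)" "- 3 * e"] chi[of \<tau>] d(2)[of \<tau>] e by auto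
      qed (use chi1[of \<tau>] e in \<open>simp add: G_def\<close>)
    qed
    consider "x = 0" | "x > 0" | "x < 0" by linarith
    then show "dist (H (x, 0)) (g x, 0) \<le> 6 * e"
    proof cases
      case 1
      then show ?thesis using fin e t1 g0 by (simp add: T_def i0 bend_def)
    next
      case 2
      have T: "T x = inv r x" using 2 by (simp add: T_def i0)
      have ix: "0 \<le> inv r x" "c * inv r x \<le> x" "r (inv r x) = x" using inr 2 by auto
      have "inv r x \<noteq> 0" using ix(3) r0 2 by auto
      then have p: "0 < inv r x" using ix by simp
      have "C (inv r x, x) = x" unfolding C_def using rp[OF p] ix 2 by auto
      then have "bend (inv r x, x) = F (inv r x)"
        using low[of "inv r x"] rp[OF p] 2 ix by (auto simp: bend_def K_def)
      then show ?thesis using fin Fn[of "inv r x"] T ix A1[of x] 2 x by auto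
    next
      case 3
      have T: "T x = inv l (- x)" using 3 by (simp add: T_def i0)
      have ix: "0 \<le> inv l (- x)" "c * inv l (- x) \<le> - x" "l (inv l (- x)) = - x" using inl 3 by auto
      have "inv l (- x) \<noteq> 0" using ix(3) r0 3 by auto
      then have p: "0 < inv l (- x)" using ix by simp
      have "C (inv l (- x), x) = x" unfolding C_def using rp[OF p] ix 3 by auto
      then have "bend (inv l (- x), x) = G (inv l (- x))"
        using low[of "inv l (- x)"] ix by (auto simp: bend_def)
      then show ?thesis using fin Fn[of "inv l (- x)"] T ix B1[of "- x"] 3 x by auto
    qed
  qed
qed

section \<open>Departures and contour points\<close>

definition affine_near :: "(real \<Rightarrow> real) \<Rightarrow> real \<Rightarrow> bool" where
  "affine_near h x \<longleftrightarrow> (\<exists>d>0. \<exists>m q. \<forall>z. \<bar>z - x\<bar> < d \<longrightarrow> h z = m * z + q)"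

lemma affine_near_uminus: "affine_near uminus x"
  unfolding affine_near_def by (intro exI[of _ 1] conjI exI[of _ "-1"] exI[of _ 0]) auto

lemma affine_near_compose:
  assumes "affine_near f (g x)" "affine_near g x"
  shows "affine_near (f \<circ> g) x"
proof -
  obtain d m q where d: "d > 0" "\<And>z. \<bar>z - g x\<bar> < d \<Longrightarrow> f z = m * z + q"
    using assms(1) unfolding affine_near_def by blast
  obtain d' m' q' where d': "d' > 0" "\<And>z. \<bar>z - x\<bar> < d' \<Longrightarrow> g z = m' * z + q'"
    using assms(2) unfolding affine_near_def by blast
  have "(f \<circ> g) z = (m * m') * z + (m * q' + q)" if z: "\<bar>z - x\<bar> < min d' (d / (\<bar>m'\<bar> + 1))" for z
  proof -
    have "g z - g x = m' * (z - x)" using d'(2)[of z] d'(2)[of x] z d'(1) by (simp add: algebra_simps)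
    then have "\<bar>g z - g x\<bar> = \<bar>m'\<bar> * \<bar>z - x\<bar>" by (simp add: abs_mult)
    also have "\<dots> \<le> (\<bar>m'\<bar> + 1) * \<bar>z - x\<bar>" by (intro mult_right_mono) auto
    also have "\<dots> < d" using z by (simp add: field_simps)
    finally show ?thesis using d(2)[of "g z"] d'(2)[of z] z by (simp add: algebra_simps)
  qed
  moreover have "0 < min d' (d / (\<bar>m'\<bar> + 1))" using d d' by simp
  ultimately show ?thesis unfolding affine_near_def by blast
qed

lemma piecewise_linear_on_affine_near:
  assumes "piecewise_linear_on a b f"
  shows "\<exists>B. finite B \<and> (\<forall>x\<in>{a<..<b} - B. affine_near f x)"
proof -
  obtain k c where c: "c 0 = a" "c k = b" "\<And>i. i < k \<Longrightarrow> c i < c (Suc i)"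
    "\<And>i. i < k \<Longrightarrow> \<exists>m q. \<forall>x\<in>{c i..c (Suc i)}. f x = m * x + q"
    using assms unfolding piecewise_linear_on_def by blast
  have "affine_near f x" if x: "a < x" "x < b" "x \<notin> c ` {..k}" for x
  proof -
    define i where "i = Max {i. i \<le> k \<and> c i \<le> x}"
    have i: "i \<in> {i. i \<le> k \<and> c i \<le> x}"
      unfolding i_def using x c by (intro Max_in) (auto intro!: exI[of _ 0])
    then have "i \<noteq> k" using x c by auto
    then have ik: "i < k" using i by simp
    have "x < c (Suc i)"
    proof (rule ccontr)
      assume "\<not> x < c (Suc i)"
      then have "Suc i \<in> {i. i \<le> k \<and> c i \<le> x}" using ik by simp
      then have "Suc i \<le> i" unfolding i_def by (intro Max_ge) auto
      then show False by simp
    qed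
    moreover have "c i < x" using i x(3) by (cases "c i = x") auto
    ultimately have lt: "c i < x" "x < c (Suc i)" by auto
    obtain m q where "\<forall>x\<in>{c i..c (Suc i)}. f x = m * x + q" using c(4)[OF ik] by blast
    then have "\<forall>z. \<bar>z - x\<bar> < min (x - c i) (c (Suc i) - x) \<longrightarrow> f z = m * z + q" by (auto simp: abs_less_iff)
    moreover have "0 < min (x - c i) (c (Suc i) - x)" using lt by simp
    ultimately show ?thesis unfolding affine_near_def by blast
  qed
  then show ?thesis by (intro exI[of _ "c ` {..k}"]) auto
qed

lemma departure_uminus: "departure (\<lambda>x. - h x) x = departure h x"
  by (auto simp: departure_def image_def)

lemma positive_departure_uminus: "positive_departure (\<lambda>x. - h x) x = negative_departure h x"
  "negative_departure (\<lambda>x. - h x) x = positive_departure h x"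
  by (auto simp: positive_departure_def negative_departure_def departure_uminus)

lemma contour_point_uminus: "contour_point (\<lambda>x. - h x) x = contour_point h x"
  by (auto simp: contour_point_def opposite_departures_def positive_departure_uminus departure_uminus)

locale pointed_map =
  fixes h :: "real \<Rightarrow> real"
  assumes cont: "continuous_on {0..1} h" and h0: "h 0 = 0"
begin

text \<open>Negation exchanges the two orientations, so the facts below are proved for positive
  departures and interpreted at \<open>- h\<close> for negative ones.\<close>

lemma uminus: "pointed_map (\<lambda>x. - h x)"
  by unfold_locales (auto intro!: continuous_intros cont simp: h0)

lemma departure_cases:
  assumes "departure h d"
  obtains "positive_departure h d" | "negative_departure h d"
proof -
  have "h d \<noteq> h 0" using assms by (auto simp: departure_def image_def)
  then consider "0 < h d" | "h d < 0" using h0 by linarith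
  then show ?thesis
    using that assms by cases (auto simp: positive_departure_def negative_departure_def)
qed

text \<open>Starting from \<open>h 0 = 0\<close>, an earlier value at least \<open>h d\<close> would
  force \<open>h d\<close> itself to be taken earlier. Departures are thus strict records.\<close>

lemma positive_departure_greater:
  assumes "positive_departure h d" "0 \<le> x" "x < d"
  shows "h x < h d"
proof (rule ccontr)
  assume "\<not> h x < h d"
  moreover have d: "0 < h d" "d \<le> 1" "h d \<notin> h ` {0..<d}"
    using assms by (auto simp: positive_departure_def departure_def)
  moreover have "continuous_on {0..x} h" using assms d by (intro continuous_on_subset[OF cont]) auto
  ultimately obtain z where "0 \<le> z" "z \<le> x" "h z = h d"
    using IVT'[of h 0 "h d" x] assms h0 by auto
  then have "h d \<in> h ` {0..<d}" using assms by (intro image_eqI[of _ _ z]) auto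
  then show False using d by simp
qed

lemma positive_departureI:
  assumes "0 < d" "d \<le> 1" "0 < h d" "\<And>x. 0 \<le> x \<Longrightarrow> x < d \<Longrightarrow> h x < h d"
  shows "positive_departure h d"
  using assms by (force simp: positive_departure_def departure_def)

lemma first_max:
  assumes "0 \<le> b" "b \<le> 1"
  obtains d where "0 \<le> d" "d \<le> b" "\<And>x. 0 \<le> x \<Longrightarrow> x \<le> b \<Longrightarrow> h x \<le> h d"
    "\<And>x. 0 \<le> x \<Longrightarrow> x < d \<Longrightarrow> h x < h d"
proof -
  have c: "continuous_on {0..b} h" using assms by (intro continuous_on_subset[OF cont]) auto
  obtain s where s: "s \<in> {0..b}" "\<And>x. x \<in> {0..b} \<Longrightarrow> h x \<le> h s"
    using continuous_attains_sup[OF _ _ c] assms by auto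
  define K where "K = {x \<in> {0..b}. h x = h s}"
  have "closed K" unfolding K_def using continuous_closed_preimage_constant[OF c] by simp
  moreover have "bounded K" unfolding K_def by (rule bounded_subset[of "{0..b}"]) auto
  ultimately have "compact K" by (simp add: compact_eq_bounded_closed)
  moreover have "K \<noteq> {}" using s by (auto simp: K_def)
  ultimately obtain d where d: "d \<in> K" "\<And>x. x \<in> K \<Longrightarrow> d \<le> x" using compact_attains_inf by metis
  show ?thesis
  proof (rule that[of d])
    show "h x < h d" if "0 \<le> x" "x < d" for x
      using d(1) d(2)[of x] s(2)[of x] that by (force simp: K_def)
  qed (use d s in \<open>auto simp: K_def\<close>)
qed

text \<open>Let \<open>w\<close> be the infimum of the later negative departures, or 1 if there are
  none. The first maximum on \<open>[0, w]\<close> is the required point: a later positive departure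
  exceeds this maximum, so it lies beyond \<open>w\<close> and a negative departure precedes
  it.\<close>

lemma contour_point_ge:
  assumes d: "positive_departure h d"
  obtains \<alpha> where "contour_point h \<alpha>" "positive_departure h \<alpha>" "d \<le> \<alpha>"
    "\<And>y. negative_departure h y \<Longrightarrow> d < y \<Longrightarrow> \<alpha> < y"
proof -
  interpret n: pointed_map "\<lambda>x. - h x" by (rule uminus)
  define W where "W = {y. negative_departure h y \<and> d < y}"
  define w where "w = (if W = {} then 1 else Inf W)"
  have d1: "0 < d" "d \<le> 1" "0 < h d" using d by (auto simp: positive_departure_def departure_def)
  have bdd: "bdd_below W" unfolding W_def bdd_below_def by (intro exI[of _ d]) auto
  have W1: "y \<le> 1" if "y \<in> W" for y using that by (auto simp: W_def negative_departure_def departure_def)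
  have w: "d \<le> w" "w \<le> 1" "\<And>y. y \<in> W \<Longrightarrow> w \<le> y"
  proof -
    show "d \<le> w" unfolding w_def using d1 by (auto intro!: cInf_greatest simp: W_def)
    show wy: "w \<le> y" if "y \<in> W" for y unfolding w_def using that bdd by (auto intro: cInf_lower)
    show "w \<le> 1"
    proof (cases "W = {}")
      case False
      then show ?thesis using wy W1 by fastforce
    qed (simp add: w_def)
  qed
  obtain \<alpha> where a: "0 \<le> \<alpha>" "\<alpha> \<le> w" "\<And>x. 0 \<le> x \<Longrightarrow> x \<le> w \<Longrightarrow> h x \<le> h \<alpha>" "\<And>x. 0 \<le> x \<Longrightarrow> x < \<alpha> \<Longrightarrow> h x < h \<alpha>"
    using first_max[of w] w d1 by auto
  have ad: "h d \<le> h \<alpha>" using a(3)[of d] w d1 by simp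
  then have da: "d \<le> \<alpha>" using positive_departure_greater[OF d, of \<alpha>] a by force
  have pa: "positive_departure h \<alpha>" using a da d1 w less_le_trans[OF d1(3) ad] by (intro positive_departureI) auto
  have neg: "\<alpha> < y" if "negative_departure h y" "d < y" for y
  proof -
    have "\<alpha> \<le> y" using w(3)[of y] that a by (auto simp: W_def)
    moreover have "\<alpha> \<noteq> y" using pa that by (auto simp: positive_departure_def negative_departure_def)
    ultimately show ?thesis by simp
  qed
  have "contour_point h \<alpha>"
    unfolding contour_point_def
  proof (intro conjI allI impI)
    show "departure h \<alpha>" using pa by (simp add: positive_departure_def)
    fix x assume x: "departure h x \<and> \<alpha> < x"
    then have "departure h x" by simp
    then show "\<exists>y. opposite_departures h \<alpha> y \<and> \<alpha> < y \<and> y \<le> x"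
    proof (cases rule: departure_cases)
      case 1
      then have "h \<alpha> < h x" using positive_departure_greater[of x \<alpha>] x a by auto
      then have wx: "w < x" using a(3)[of x] x a(1) by (meson less_le_not_le less_le_trans not_less order.strict_implies_order)
      have "x \<le> 1" using x by (simp add: departure_def)
      then have "W \<noteq> {}" "Inf W < x" using wx by (auto simp: w_def split: if_splits)
      then obtain y where "y \<in> W" "y < x" using cInf_lessD by blast
      then show ?thesis using neg[of y] pa by (auto simp: W_def opposite_departures_def intro!: exI[of _ y])
    next
      case 2
      then show ?thesis using pa x by (auto simp: opposite_departures_def)
    qed
  qed
  then show ?thesis using that pa da neg by blast
qed

text \<open>Values before a positive departure are smaller, so an affine piece around it has
  positive slope and continues with further positive departures, with no negative one in
  between.\<close>

lemma not_affine_near_contour_point: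
  assumes c: "contour_point h \<alpha>" and p: "positive_departure h \<alpha>" and "\<alpha> < 1"
  shows "\<not> affine_near h \<alpha>"
proof
  assume "affine_near h \<alpha>"
  then obtain d m q where d: "d > 0" "\<And>z. \<bar>z - \<alpha>\<bar> < d \<Longrightarrow> h z = m * z + q" unfolding affine_near_def by blast
  have a: "0 < \<alpha>" "0 < h \<alpha>" using p by (auto simp: positive_departure_def departure_def)
  define z where "z = \<alpha> - min d \<alpha> / 2"
  have z: "0 \<le> z" "z < \<alpha>" "\<bar>z - \<alpha>\<bar> < d" using a d by (auto simp: z_def min_def)
  have "h z < h \<alpha>" using positive_departure_greater[OF p] z by simp
  then have "m * z < m * \<alpha>" using d(2)[of z] d(2)[of \<alpha>] d(1) z by simp
  then have m: "0 < m" using z(2) by (auto simp: mult_less_cancel_left)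
  define x where "x = \<alpha> + min d (1 - \<alpha>) / 2"
  have x: "\<alpha> < x" "x < \<alpha> + d" "x \<le> 1"
    using assms(3) d(1) unfolding x_def by (auto simp: min_def field_simps)
  have inc: "h y < h y'" if "\<alpha> \<le> y" "y < y'" "y' \<le> x" for y y'
    using d(2)[of y] d(2)[of y'] that x m by simp
  have pos: "positive_departure h x"
  proof (rule positive_departureI)
    show "h y < h x" if "0 \<le> y" "y < x" for y
    proof (cases "y < \<alpha>")
      case True
      then show ?thesis using positive_departure_greater[OF p, of y] inc[of \<alpha> x] x that by simp
    next
      case False
      then show ?thesis using inc[of y x] that by simp
    qed
    show "0 < h x" using inc[of \<alpha> x] x a by simp
  qed (use x a in auto)
  then obtain y where y: "opposite_departures h \<alpha> y" "\<alpha> < y" "y \<le> x"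
    using c x unfolding contour_point_def positive_departure_def by blast
  then have "h y < 0" using p by (auto simp: opposite_departures_def positive_departure_def negative_departure_def)
  then show False using inc[of \<alpha> y] y a by simp
qed

text \<open>A negative departure in between would yield, by \<open>contour_point_ge\<close> for
  \<open>- h\<close>, a contour point after it and still before the positive departure
  \<open>b\<close>.\<close>

lemma no_departure_between:
  assumes b: "contour_point h b" "positive_departure h b" and none: "\<And>\<alpha>. contour_point h \<alpha> \<Longrightarrow> \<alpha> \<le> a \<or> b \<le> \<alpha>"
    and y: "negative_departure h y" "y < b"
  shows "y \<le> a"
proof -
  interpret n: pointed_map "\<lambda>x. - h x" by (rule uminus)
  obtain \<alpha> where a: "contour_point h \<alpha>" "y \<le> \<alpha>" "\<And>z. positive_departure h z \<Longrightarrow> y < z \<Longrightarrow> \<alpha> < z"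
    using n.contour_point_ge[of y] y unfolding positive_departure_uminus contour_point_uminus by blast
  then show ?thesis using a(3)[OF b(2) y(2)] none[OF a(1)] by simp
qed

text \<open>Consecutive contour points have opposite orientations, since a positive \<open>a\<close>
  would need a negative departure before \<open>b\<close>. The first minimum on
  \<open>[0, b]\<close> is 0 or a negative departure, so it does not lie beyond \<open>a\<close>;
  and \<open>a\<close>, being 0 or a negative departure, is a record low.\<close>

lemma node_bounds:
  assumes b: "contour_point h b" "positive_departure h b" and ab: "a < b"
    and a: "a = 0 \<or> contour_point h a" and none: "\<And>\<alpha>. contour_point h \<alpha> \<Longrightarrow> \<alpha> \<le> a \<or> b \<le> \<alpha>"
    and x: "0 \<le> x" "x \<le> b"
  shows "h a \<le> 0" "h a \<le> h x" "h x \<le> h b"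
proof -
  interpret n: pointed_map "\<lambda>x. - h x" by (rule uminus)
  have b01: "0 < b" "b \<le> 1" "0 < h b" "departure h b" using b by (auto simp: positive_departure_def departure_def)
  show "h x \<le> h b" using positive_departure_greater[OF b(2), of x] x by (cases "x = b") auto
  have an: "a = 0 \<or> negative_departure h a"
  proof (rule ccontr)
    assume "\<not> ?thesis"
    then have c: "contour_point h a" "positive_departure h a"
      using a departure_cases[of a] unfolding contour_point_def by auto
    then obtain y where y: "opposite_departures h a y" "a < y" "y \<le> b"
      using b01 ab unfolding contour_point_def by blast
    then have yn: "negative_departure h y" using c
      by (auto simp: opposite_departures_def positive_departure_def negative_departure_def)
    moreover have "y \<noteq> b" using yn b01 by (auto simp: negative_departure_def)
    ultimately show False using no_departure_between[OF b none] y by fastforce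
  qed
  then show "h a \<le> 0" using h0 by (auto simp: negative_departure_def)
  obtain d where d: "0 \<le> d" "d \<le> b" "\<And>x. 0 \<le> x \<Longrightarrow> x \<le> b \<Longrightarrow> - h x \<le> - h d" "\<And>x. 0 \<le> x \<Longrightarrow> x < d \<Longrightarrow> - h x < - h d"
    using n.first_max[of b] b01 by auto
  have a0: "0 \<le> a" using an by (auto simp: negative_departure_def departure_def)
  have "h a \<le> h d"
  proof (cases "d = 0")
    case True
    then show ?thesis using \<open>h a \<le> 0\<close> h0 by simp
  next
    case False
    have "h d < 0" using d(4)[of 0] d(1) False h0 by simp
    then have dn: "negative_departure h d"
      using n.positive_departureI[of d] d b01 False by (auto simp: positive_departure_uminus)
    have "d < b" using d \<open>h d < 0\<close> b01 by (cases "d = b") auto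
    then have "d \<le> a" using no_departure_between[OF b none dn] by simp
    moreover have "a \<noteq> 0" using \<open>d \<le> a\<close> d(1) False by auto
    ultimately show ?thesis using n.positive_departure_greater[of a d] an d
      by (cases "d = a") (auto simp: positive_departure_uminus)
  qed
  then show "h a \<le> h x" using d(3)[of x] x by simp
qed

text \<open>Each departure is followed by a contour point, so none lies beyond \<open>b\<close>. The
  first maximum and the first minimum on \<open>[0, 1]\<close> are 0 or departures, and
  \<open>node_bounds\<close> applies to them.\<close>

lemma last_node_bounds:
  assumes b: "contour_point h b" "positive_departure h b" and ab: "a < b"
    and a: "a = 0 \<or> contour_point h a" and none: "\<And>\<alpha>. contour_point h \<alpha> \<Longrightarrow> \<alpha> \<le> a \<or> \<alpha> = b"
    and x: "0 \<le> x" "x \<le> 1"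
  shows "h a \<le> h x" "h x \<le> h b"
proof -
  interpret n: pointed_map "\<lambda>x. - h x" by (rule uminus)
  have b01: "0 < b" "b \<le> 1" "0 < h b" "departure h b" using b by (auto simp: positive_departure_def departure_def)
  have none': "\<alpha> \<le> a \<or> b \<le> \<alpha>" if "contour_point h \<alpha>" for \<alpha> using none[OF that] by auto
  note nb = node_bounds[OF b ab a none']
  obtain d where d: "0 \<le> d" "d \<le> 1" "\<And>x. 0 \<le> x \<Longrightarrow> x \<le> 1 \<Longrightarrow> h x \<le> h d" "\<And>x. 0 \<le> x \<Longrightarrow> x < d \<Longrightarrow> h x < h d"
    using first_max[of 1] by auto
  have hd: "0 < h d" using d(3)[of b] b01 by simp
  then have "d \<noteq> 0" using h0 by auto
  then have "positive_departure h d" using d hd by (intro positive_departureI) auto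
  then obtain \<alpha> where "contour_point h \<alpha>" "d \<le> \<alpha>" using contour_point_ge by blast
  then have "d \<le> b" using none[of \<alpha>] ab by auto
  then show "h x \<le> h b" using nb(3)[of d] d(3)[of x] d(1) x by simp
  obtain d where d: "0 \<le> d" "d \<le> 1" "\<And>x. 0 \<le> x \<Longrightarrow> x \<le> 1 \<Longrightarrow> - h x \<le> - h d" "\<And>x. 0 \<le> x \<Longrightarrow> x < d \<Longrightarrow> - h x < - h d"
    using n.first_max[of 1] by auto
  have "d \<le> b"
  proof (cases "d = 0")
    case False
    have "h d < 0" using d(4)[of 0] d(1) False h0 by simp
    then have "negative_departure h d"
      using n.positive_departureI[of d] d False by (auto simp: positive_departure_uminus)
    then obtain \<alpha> where \<alpha>: "contour_point h \<alpha>" "d \<le> \<alpha>"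
      using n.contour_point_ge[of d] unfolding positive_departure_uminus contour_point_uminus by blast
    then show ?thesis using none[of \<alpha>] ab by auto
  qed (use b01 in simp)
  then show "h a \<le> h x" using nb(2)[of d] d(3)[of x] d(1) x by simp
qed

end

section \<open>Lifting through a piecewise-linear zigzag\<close>

lemma first_hit:
  fixes u :: "real \<Rightarrow> real"
  assumes "continuous_on {0..1} u" "c \<in> u ` {0..1}"
  shows "\<exists>b. 0 \<le> b \<and> b \<le> 1 \<and> u b = c \<and> (\<forall>z. 0 \<le> z \<longrightarrow> z < b \<longrightarrow> u z \<noteq> c)"
proof -
  define K where "K = {x \<in> {0..1}. u x = c}"
  have "closed K" unfolding K_def using continuous_closed_preimage_constant[OF assms(1)] by simp
  moreover have "bounded K" unfolding K_def by (rule bounded_subset[of "{0..1}"]) auto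
  ultimately have "compact K" by (simp add: compact_eq_bounded_closed)
  moreover have "K \<noteq> {}" using assms by (auto simp: K_def)
  ultimately obtain b where "b \<in> K" "\<And>x. x \<in> K \<Longrightarrow> b \<le> x" using compact_attains_inf by metis
  then show ?thesis by (intro exI[of _ b]) (force simp: K_def)
qed

text \<open>Abstract form of a contour factor with nodes \<open>v i\<close> at \<open>i / n\<close>.
  The condition \<open>out\<close> retains from contour points only that each node is a new value;
  it forces a path to visit the nodes in order.\<close>

locale zigzag =
  fixes n :: nat and v :: "nat \<Rightarrow> real" and T :: "real \<Rightarrow> real"
  assumes n: "0 < n" and v0: "v 0 = 0"
    and ne: "\<And>i. i < n \<Longrightarrow> v i \<noteq> v (Suc i)"
    and out: "\<And>i. Suc i < n \<Longrightarrow> v (Suc (Suc i)) \<notin> closed_segment (v i) (v (Suc i))"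
    and T: "\<And>y. 0 \<le> y \<Longrightarrow> y \<le> 1 \<Longrightarrow> T y = (\<Sum>i<n. (v (Suc i) - v i) * clamp01 (real n * y - real i))"
begin

lemma T_eq:
  assumes "j < n" "real j \<le> real n * y" "real n * y \<le> real (Suc j)" "0 \<le> y" "y \<le> 1"
  shows "T y = v j + (v (Suc j) - v j) * (real n * y - real j)"
proof -
  have "(\<Sum>m<j. v (Suc m) - v m) = v j - v 0" by (induction j) auto
  then show ?thesis using T[OF assms(4,5)] sum_clamp01[OF assms(1-3)] v0 by simp
qed

lemma T_0: "T 0 = 0" using T_eq[of 0 0] n v0 by simp

lemma continuous_T: "continuous_on {0..1} T"
proof -
  have "continuous_on {0..1} (\<lambda>y. \<Sum>i<n. (v (Suc i) - v i) * clamp01 (real n * y - real i))"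
    by (intro continuous_intros)
  then show ?thesis by (rule continuous_on_eq) (simp add: T)
qed

lemma T_bounds:
  assumes v: "\<And>i. i \<le> n \<Longrightarrow> \<bar>v i\<bar> \<le> 1" and y: "0 \<le> y" "y \<le> 1"
  shows "\<bar>T y\<bar> \<le> 1"
proof -
  define j where "j = min (nat \<lfloor>real n * y\<rfloor>) (n - 1)"
  have "real n * y \<le> real n" "0 \<le> real n * y" using y by (auto simp: mult_left_le)
  then have j: "j < n" "real j \<le> real n * y" "real n * y \<le> real (Suc j)"
    unfolding j_def using n by (auto simp: min_def) linarith+
  define t where "t = real n * y - real j"
  have t: "0 \<le> t" "t \<le> 1" using j by (auto simp: t_def)
  have eq: "T y = (1 - t) * v j + t * v (Suc j)"
    using T_eq[OF j y] unfolding t_def[symmetric] by (simp add: algebra_simps)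
  have "\<bar>T y\<bar> \<le> (1 - t) * \<bar>v j\<bar> + t * \<bar>v (Suc j)\<bar>"
    unfolding eq using t by (intro order.trans[OF abs_triangle_ineq]) (simp add: abs_mult)
  also have "\<dots> \<le> (1 - t) * 1 + t * 1"
    using t v[of j] v[of "Suc j"] j by (intro add_mono mult_left_mono) auto
  finally show ?thesis by simp
qed

text \<open>\<open>N\<close> follows \<open>u\<close> on the segment from \<open>v i\<close> to \<open>v (Suc i)\<close> between the first times at which \<open>u\<close>
  reaches these two nodes.\<close>

lemma lift:
  fixes u :: "real \<Rightarrow> real"
  assumes cu: "continuous_on {0..1} u" and u0: "u 0 = 0"
    and H: "\<And>i y. \<lbrakk>i < n; 0 \<le> y; y \<le> 1; Suc i = n \<or> v (Suc i) \<notin> u ` {0..<y}\<rbrakk>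
      \<Longrightarrow> u y \<in> closed_segment (v i) (v (Suc i))"
  shows "\<exists>N. continuous_on {0..1} N \<and> N \<in> {0..1} \<rightarrow> {0..1} \<and> N 0 = 0 \<and> (\<forall>y\<in>{0..1}. T (N y) = u y) \<and>
    (v n \<in> u ` {0..1} \<longrightarrow> 1 \<in> N ` {0..1})"
proof -
  \<comment> \<open>A node is reached only after its predecessor: until the predecessor is hit,
    \<open>H\<close> confines \<open>u\<close> to the segment ending there, and \<open>out\<close>
    says that this segment misses the node.\<close>
  have down: "\<exists>z. 0 \<le> z \<and> z \<le> y \<and> u z = v i" if "0 \<le> y" "y \<le> 1" "u y = v (Suc i)" "Suc i \<le> n" for i y
  proof (cases i)
    case 0
    then show ?thesis using that u0 v0 by (intro exI[of _ 0]) auto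
  next
    case (Suc j)
    then have "v (Suc j) \<in> u ` {0..<y}" using H[of j y] out[of j] that by force
    then show ?thesis using Suc by auto
  qed
  define hit where "hit = (\<lambda>i. v i \<in> u ` {0..1})"
  have "\<exists>b. hit i \<longrightarrow> 0 \<le> b \<and> b \<le> 1 \<and> u b = v i \<and> (\<forall>z. 0 \<le> z \<longrightarrow> z < b \<longrightarrow> u z \<noteq> v i)" for i
    using first_hit[OF cu, of "v i"] unfolding hit_def by blast
  then obtain b where b: "\<And>i. hit i \<Longrightarrow> 0 \<le> b i \<and> b i \<le> 1 \<and> u (b i) = v i \<and> (\<forall>z. 0 \<le> z \<longrightarrow> z < b i \<longrightarrow> u z \<noteq> v i)"
    by metis
  have hit0: "hit 0" unfolding hit_def using u0 v0 by (intro image_eqI[of _ _ 0]) auto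
  define k where "k = Max {i. i < n \<and> hit i}"
  have k: "k \<in> {i. i < n \<and> hit i}" unfolding k_def using hit0 n by (intro Max_in) auto
  have kmax: "i \<le> k" if "i < n" "hit i" for i unfolding k_def using that by (intro Max_ge) auto
  have hitk: "hit i" if "i \<le> k" for i
    using that
  proof (induction i rule: inc_induct)
    case (step m)
    note B = b[OF step.IH]
    obtain z where "0 \<le> z" "z \<le> b (Suc m)" "u z = v m" using down[of "b (Suc m)" m] B step.hyps k by auto
    then show ?case using B unfolding hit_def by (intro image_eqI[of _ _ z]) auto
  qed (use k in simp)
  have bstep: "b i \<le> b (Suc i)" if i: "Suc i \<le> k" for i
  proof -
    note B = b[OF hitk[OF i]]
    obtain z where "0 \<le> z" "z \<le> b (Suc i)" "u z = v i" using down[of "b (Suc i)" i] B i k by auto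
    moreover have "hit i" using hitk i by simp
    ultimately show ?thesis using b[of i] by (meson not_less order_trans)
  qed
  \<comment> \<open>After the last node reached among \<open>0, ..., n - 1\<close>, all remaining
    time belongs to segment \<open>k\<close>, even if node \<open>n\<close> is reached during it.
    This is why \<open>k\<close> ranges only below \<open>n\<close>.\<close>
  define b' where "b' = (\<lambda>i. if i \<le> k then b i else 1)"
  have b'01: "0 \<le> b' i" "b' i \<le> 1" for i using b[OF hitk] by (auto simp: b'_def)
  have b'mono: "b' i \<le> b' j" if "i \<le> j" for i j
    using that
  proof (induction j rule: dec_induct)
    case (step m)
    have "b' m \<le> b' (Suc m)" using bstep[of m] b'01[of m] by (auto simp: b'_def)
    then show ?case using step by simp
  qed simp
  have ub: "u (b' i) = v i" if "i \<le> k" for i using b[OF hitk[OF that]] that by (simp add: b'_def)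
  have b0: "b' 0 = 0" using b[OF hit0] u0 v0 by (force simp: b'_def)
  define c where "c = (\<lambda>i y. max (b' i) (min (b' (Suc i)) y))"
  \<comment> \<open>The clamp \<open>c i\<close> freezes \<open>u\<close> outside the time window of
    segment \<open>i\<close>, so a summand is 0 before its window and, for \<open>i < k\<close>,
    equal to 1 after it. Continuity then needs no gluing.\<close>
  define N where "N = (\<lambda>y. (\<Sum>i<Suc k. (u (c i y) - v i) / (v (Suc i) - v i)) / real n)"
  have c01: "0 \<le> c i y" "c i y \<le> 1" for i y unfolding c_def using b'01[of i] b'01[of "Suc i"] by auto
  have val: "real n * N y = real j + (u y - v j) / (v (Suc j) - v j)"
    if j: "j \<le> k" "b' j \<le> y" "y \<le> b' (Suc j)" for j y
  proof -
    have "(\<Sum>i<Suc k. (u (c i y) - v i) / (v (Suc i) - v i)) = (\<Sum>i<Suc j. (u (c i y) - v i) / (v (Suc i) - v i))"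
    proof (rule sum.mono_neutral_right)
      show "\<forall>i\<in>{..<Suc k} - {..<Suc j}. (u (c i y) - v i) / (v (Suc i) - v i) = 0"
      proof
        fix i assume i: "i \<in> {..<Suc k} - {..<Suc j}"
        then have "y \<le> b' i" using b'mono[of "Suc j" i] j by auto
        then have "c i y = b' i" using b'mono[of i "Suc i"] by (auto simp: c_def)
        then show "(u (c i y) - v i) / (v (Suc i) - v i) = 0" using ub[of i] i by simp
      qed
    qed (use j in auto)
    also have "\<dots> = (\<Sum>i<j. (u (c i y) - v i) / (v (Suc i) - v i)) + (u (c j y) - v j) / (v (Suc j) - v j)" by simp
    also have "(\<Sum>i<j. (u (c i y) - v i) / (v (Suc i) - v i)) = (\<Sum>i<j. 1)"
    proof (rule sum.cong)
      fix i assume i: "i \<in> {..<j}"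
      then have "b' (Suc i) \<le> y" using b'mono[of "Suc i" j] j by auto
      then have "c i y = b' (Suc i)" using b'mono[of i "Suc i"] by (auto simp: c_def)
      then show "(u (c i y) - v i) / (v (Suc i) - v i) = 1" using ub[of "Suc i"] i j k ne[of i] by simp
    qed simp
    also have "c j y = y" using j by (auto simp: c_def)
    finally show ?thesis using n by (simp add: N_def)
  qed
  have ex: "\<exists>j\<le>k. b' j \<le> y \<and> y \<le> b' (Suc j)" if y: "0 \<le> y" "y \<le> 1" for y
  proof -
    define j where "j = Max {j. j \<le> k \<and> b' j \<le> y}"
    have j: "j \<in> {j. j \<le> k \<and> b' j \<le> y}" unfolding j_def using b0 y by (intro Max_in) (auto intro!: exI[of _ 0])
    have "y \<le> b' (Suc j)"
    proof (rule ccontr)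
      assume y': "\<not> y \<le> b' (Suc j)"
      then have "Suc j \<le> k" using y by (auto simp: b'_def split: if_splits)
      then have "Suc j \<le> j" unfolding j_def[of ] using y' by (intro Max_ge) (auto simp: j_def[symmetric])
      then show False by simp
    qed
    then show ?thesis using j by blast
  qed
  have fr: "0 \<le> (u y - v j) / (v (Suc j) - v j) \<and> (u y - v j) / (v (Suc j) - v j) \<le> 1"
    if j: "j \<le> k" "b' j \<le> y" "y \<le> b' (Suc j)" for j y
  proof -
    have y: "0 \<le> y" "y \<le> 1" using j b'01[of j] b'01[of "Suc j"] by auto
    have "u y \<in> closed_segment (v j) (v (Suc j))"
    proof (rule H)
      show "Suc j = n \<or> v (Suc j) \<notin> u ` {0..<y}"
      proof (cases "j = k")
        case True
        then have "Suc j = n \<or> \<not> hit (Suc j)" using kmax[of "Suc j"] k by force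
        then show ?thesis using y unfolding hit_def by auto
      next
        case False
        then have "hit (Suc j)" "y \<le> b (Suc j)" using hitk[of "Suc j"] j by (auto simp: b'_def)
        then show ?thesis using b[of "Suc j"] by force
      qed
    qed (use j k y in auto)
    moreover have "v j \<noteq> v (Suc j)" using ne[of j] j k by simp
    ultimately show ?thesis
      by (auto simp: closed_segment_eq_real_ivl divide_le_eq_1 zero_le_divide_iff split: if_splits)
  qed
  have nek: "v (Suc i) \<noteq> v i" if "i < Suc k" for i using ne[of i] k that by auto
  show ?thesis
  proof (intro exI[of _ N] conjI ballI impI)
    show "continuous_on {0..1} N"
      unfolding N_def c_def using n
      by (intro continuous_intros continuous_on_compose2[OF cu]) (use c01 nek in \<open>auto simp: c_def\<close>)
    show "N \<in> {0..1} \<rightarrow> {0..1}"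
    proof
      fix y :: real assume "y \<in> {0..1}"
      then obtain j where j: "j \<le> k" "b' j \<le> y" "y \<le> b' (Suc j)" using ex[of y] by auto
      have "real (Suc j) \<le> real n" using j k by simp
      then have "0 \<le> real n * N y" "real n * N y \<le> real n * 1" using val[OF j] fr[OF j] by auto
      then show "N y \<in> {0..1}" using n by (auto simp: zero_le_mult_iff)
    qed
    show "N 0 = 0" unfolding N_def using b'01 by (auto simp: c_def ub max_absorb1 min_absorb2 intro!: sum.neutral)
    show "T (N y) = u y" if y: "y \<in> {0..1}" for y
    proof -
      obtain j where j: "j \<le> k" "b' j \<le> y" "y \<le> b' (Suc j)" using ex[of y] y by auto
      have "N y \<in> {0..1}" using \<open>N \<in> {0..1} \<rightarrow> {0..1}\<close> y by auto
      then have "T (N y) = v j + (v (Suc j) - v j) * (real n * N y - real j)"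
        using val[OF j] fr[OF j] j k by (intro T_eq) auto
      then show ?thesis using val[OF j] ne[of j] j k by simp
    qed
    assume "v n \<in> u ` {0..1}"
    then obtain y where y: "0 \<le> y" "y \<le> 1" "u y = v n" by auto
    obtain m where m: "n = Suc m" using n by (cases n) auto
    obtain z where z: "0 \<le> z" "z \<le> y" "u z = v m" using down[of y m] y m by auto
    have "hit m" unfolding hit_def using z y by (intro image_eqI[of _ _ z]) auto
    then have km: "k = m" using kmax[of m] k m by auto
    have "b m \<le> z" using b[OF \<open>hit m\<close>] z by (meson not_less)
    then have "b' k \<le> y" "y \<le> b' (Suc k)" using y z km by (auto simp: b'_def)
    then have "real n * N y = real k + 1" using val[of k y] ne[of m] km m y by simp
    then have "real n * N y = real n * 1" using km m by simp
    then have "N y = 1" using n by simp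
    then show "1 \<in> N ` {0..1}" using y by (intro image_eqI[of _ _ y]) auto
  qed
qed

end

section \<open>The contour factor as a zigzag\<close>

context pointed_map
begin

lemma contour_point_ex:
  assumes "\<not> h constant_on {0..1}"
  shows "\<exists>\<alpha>. contour_point h \<alpha>"
proof -
  have 1: "\<exists>\<alpha>. contour_point g \<alpha>" if g: "pointed_map g" "0 \<le> x" "x \<le> 1" "0 < g x" for g x
  proof -
    interpret g: pointed_map g by (rule g)
    obtain d where d: "0 \<le> d" "d \<le> 1" "\<And>x. 0 \<le> x \<Longrightarrow> x \<le> 1 \<Longrightarrow> g x \<le> g d" "\<And>x. 0 \<le> x \<Longrightarrow> x < d \<Longrightarrow> g x < g d"
      using g.first_max[of 1] by auto
    have "0 < g d" using d(3)[of x] g by simp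
    then have "positive_departure g d" using d g.h0 by (intro g.positive_departureI) (auto simp: less_le)
    then show ?thesis using g.contour_point_ge by blast
  qed
  obtain x where x: "0 \<le> x" "x \<le> 1" "h x \<noteq> 0" using assms unfolding constant_on_def by (metis atLeastAtMost_iff)
  then show ?thesis
    using 1[of h x] 1[OF uminus, of x] pointed_map_axioms by (cases "0 < h x") (auto simp: contour_point_uminus)
qed

lemma contour_segment:
  assumes b: "contour_point h b" and ab: "a < b"
    and a: "a = 0 \<or> contour_point h a" and none: "\<And>\<alpha>. contour_point h \<alpha> \<Longrightarrow> \<alpha> \<le> a \<or> b \<le> \<alpha>"
    and x: "0 \<le> x" "x \<le> 1" "x \<le> b \<or> (\<forall>\<alpha>. contour_point h \<alpha> \<longrightarrow> \<alpha> \<le> b)"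
  shows "h a \<noteq> h b" "h x \<in> closed_segment (h a) (h b)"
proof -
  interpret n: pointed_map "\<lambda>x. - h x" by (rule uminus)
  have d: "departure h b" "0 < b" "b \<le> 1" using b unfolding contour_point_def departure_def by auto
  have none': "\<alpha> \<le> a \<or> \<alpha> = b" if "contour_point h \<alpha>" "\<not> x \<le> b" for \<alpha>
    using none[of \<alpha>] x that by force
  have "h a \<noteq> h b \<and> h x \<in> closed_segment (h a) (h b)"
    using d(1)
  proof (cases rule: departure_cases)
    case 1
    then have hb: "0 < h b" by (simp add: positive_departure_def)
    have "h a \<le> h x \<and> h x \<le> h b"
      using node_bounds[OF b 1 ab a none x(1)] last_node_bounds[OF b 1 ab a none' x(1,2)]
      by (cases "x \<le> b") auto
    moreover have "h a \<le> 0" using node_bounds(1)[OF b 1 ab a none, of 0] d by simp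
    ultimately show ?thesis using hb by (auto simp: closed_segment_eq_real_ivl)
  next
    case 2
    then have hb: "h b < 0" by (simp add: negative_departure_def)
    note b' = b[folded contour_point_uminus[of h]] 2[folded positive_departure_uminus(1)[of h]]
    note nb = n.node_bounds[OF b' ab, unfolded contour_point_uminus, OF a none]
    have "h x \<le> h a \<and> h b \<le> h x"
      using nb(2,3)[of x] n.last_node_bounds[OF b' ab, unfolded contour_point_uminus, OF a none' x(1,2)] x
      by (cases "x \<le> b") auto
    moreover have "0 \<le> h a" using nb(1)[of 0] d by simp
    ultimately show ?thesis using hb by (auto simp: closed_segment_eq_real_ivl)
  qed
  then show "h a \<noteq> h b" "h x \<in> closed_segment (h a) (h b)" by auto
qed

text \<open>Supplies the hypothesis of \<open>zigzag.lift\<close>. The last clause speaks of values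
  already taken instead of contour points, so that it passes to any \<open>u\<close> for which
  \<open>h\<close> is \<open>u\<close> after a map of \<open>[0, 1]\<close> onto itself fixing
  0.\<close>

lemma contour_zigzag:
  assumes fin: "finite {\<alpha>. contour_point h \<alpha>}" and nc: "\<not> h constant_on {0..1}"
  shows "\<exists>n v. zigzag n v (contour_factor h) \<and> (\<forall>i\<le>n. v i \<in> h ` {0..1}) \<and>
    (\<forall>i y. i < n \<longrightarrow> 0 \<le> y \<longrightarrow> y \<le> 1 \<longrightarrow> Suc i = n \<or> v (Suc i) \<notin> h ` {0..<y}
      \<longrightarrow> h y \<in> closed_segment (v i) (v (Suc i)))"
proof -
  define C where "C = {\<alpha>. contour_point h \<alpha>}"
  define L where "L = contour_list h"
  define n where "n = length L - 1"
  define v where "v = (\<lambda>i. h (L ! i))"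
  have C: "0 < \<alpha>" "\<alpha> \<le> 1" if "\<alpha> \<in> C" for \<alpha> using that by (auto simp: C_def contour_point_def departure_def)
  have finC: "finite C" using fin by (simp add: C_def)
  have "Min (insert 0 C) = 0" using C finC by (intro Min_eqI) (auto intro: less_imp_le)
  moreover have "insert 0 C - {0} = C" using C by auto
  ultimately have L: "L = 0 # sorted_list_of_set C"
    unfolding L_def contour_list_def C_def[symmetric] using finC by (subst sorted_list_of_set_nonempty) auto
  have sorted: "sorted L" "distinct L" unfolding L_def contour_list_def by auto
  have "C \<noteq> {}" using contour_point_ex[OF nc] by (auto simp: C_def)
  then have n: "0 < n" "length L = Suc n" using finC by (auto simp: n_def L card_gt_0_iff)
  have LC: "L ! Suc i \<in> C" if "i < n" for i
    using nth_mem[of i "sorted_list_of_set C"] finC that n by (simp add: L)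
  have L0: "L ! 0 = 0" by (simp add: L)
  have Lt: "L ! i < L ! j" if "i < j" "j \<le> n" for i j
    using sorted_nth_mono[OF sorted(1), of i j] nth_eq_iff_index_eq[OF sorted(2), of i j] that n by force
  have La: "L ! i = 0 \<or> contour_point h (L ! i)" if "i \<le> n" for i
    using LC[of "i - 1"] L0 that by (cases i) (auto simp: C_def)
  have L01: "0 \<le> L ! i" "L ! i \<le> 1" if "i \<le> n" for i
    using La[OF that] C[of "L ! i"] by (auto simp: C_def less_imp_le)
  have idx: "\<exists>j\<le>n. \<alpha> = L ! j" if "contour_point h \<alpha>" for \<alpha>
  proof -
    have "\<alpha> \<in> set L" using that finC by (simp add: L C_def)
    then show ?thesis using n by (auto simp: in_set_conv_nth less_Suc_eq_le)
  qed
  have none: "\<alpha> \<le> L ! i \<or> L ! Suc i \<le> \<alpha>" if \<alpha>: "contour_point h \<alpha>" and i: "i < n" for \<alpha> i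
  proof -
    obtain j where j: "j \<le> n" "\<alpha> = L ! j" using idx[OF \<alpha>] by blast
    show ?thesis
    proof (cases "j \<le> i")
      case True
      then show ?thesis using sorted_nth_mono[OF sorted(1), of j i] i j n by simp
    next
      case False
      then show ?thesis using sorted_nth_mono[OF sorted(1), of "Suc i" j] i j n by simp
    qed
  qed
  have last: "\<alpha> \<le> L ! n" if \<alpha>: "contour_point h \<alpha>" for \<alpha>
  proof -
    obtain j where "j \<le> n" "\<alpha> = L ! j" using idx[OF \<alpha>] by blast
    then show ?thesis using sorted_nth_mono[OF sorted(1), of j n] n by simp
  qed
  have seg: "v i \<noteq> v (Suc i)" "h x \<in> closed_segment (v i) (v (Suc i))"
    if "i < n" "0 \<le> x" "x \<le> 1" "Suc i = n \<or> x \<le> L ! Suc i" for i x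
  proof -
    have "x \<le> L ! Suc i \<or> (\<forall>\<alpha>. contour_point h \<alpha> \<longrightarrow> \<alpha> \<le> L ! Suc i)" using that last by auto
    then show "v i \<noteq> v (Suc i)" "h x \<in> closed_segment (v i) (v (Suc i))"
      using contour_segment[of "L ! Suc i" "L ! i" x] LC[of i] Lt[of i "Suc i"] La[of i] none[of _ i] that
      unfolding v_def C_def by auto
  qed
  have "zigzag n v (contour_factor h)"
  proof
    show "0 < n" "v 0 = 0" using n L0 h0 by (auto simp: v_def)
    show "v i \<noteq> v (Suc i)" if "i < n" for i using seg(1)[of i 0] that L01[of "Suc i"] by simp
    show "v (Suc (Suc i)) \<notin> closed_segment (v i) (v (Suc i))" if i: "Suc i < n" for i
    proof
      assume "v (Suc (Suc i)) \<in> closed_segment (v i) (v (Suc i))"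
      \<comment> \<open>All values between two nodes are taken between the corresponding contour
        points, hence before the next contour point, whose value is new.\<close>
      moreover have "closed_segment (v i) (v (Suc i)) \<subseteq> h ` {L ! i..L ! Suc i}"
      proof (rule closed_segment_subset)
        have "connected (h ` {L ! i..L ! Suc i})"
          using L01[of i] L01[of "Suc i"] i
          by (intro connected_continuous_image continuous_on_subset[OF cont]) auto
        then show "convex (h ` {L ! i..L ! Suc i})" by (simp add: is_interval_connected_1 flip: is_interval_convex_1)
      qed (use Lt[of i "Suc i"] i in \<open>auto simp: v_def\<close>)
      ultimately have "h (L ! Suc (Suc i)) \<in> h ` {L ! i..L ! Suc i}" by (auto simp: v_def)
      moreover have "h (L ! Suc (Suc i)) \<notin> h ` {0..<L ! Suc (Suc i)}"
        using LC[OF i] by (simp add: C_def contour_point_def departure_def)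
      moreover have "{L ! i..L ! Suc i} \<subseteq> {0..<L ! Suc (Suc i)}"
        using L01[of i] Lt[of "Suc i" "Suc (Suc i)"] i by auto
      ultimately show False by blast
    qed
    fix y :: real assume y: "0 \<le> y" "y \<le> 1"
    define j where "j = min (nat \<lfloor>real n * y\<rfloor>) (n - 1)"
    have "real n * y \<le> real n" "0 \<le> real n * y" using y by (auto simp: mult_left_le)
    then have j: "j < n" "real j \<le> real n * y" "real n * y \<le> real (Suc j)"
      unfolding j_def using n by (auto simp: min_def) linarith+
    have "y \<in> {real j / real n..real (Suc j) / real n}" using j by (auto simp: field_simps)
    then have "contour_factor h y = linepath (v j) (v (Suc j)) (real n * y - real j)"
      using contour_factor_segment[of n h j y] j unfolding n_def L_def v_def by auto
    moreover have "(\<Sum>m<j. v (Suc m) - v m) = v j - v 0" by (induction j) auto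
    ultimately show "contour_factor h y = (\<Sum>i<n. (v (Suc i) - v i) * clamp01 (real n * y - real i))"
      using sum_clamp01[OF j, of "\<lambda>i. v (Suc i) - v i"] \<open>v 0 = 0\<close> by (simp add: linepath_def algebra_simps)
  qed
  moreover have "v i \<in> h ` {0..1}" if "i \<le> n" for i using L01[OF that] by (auto simp: v_def)
  moreover have "h y \<in> closed_segment (v i) (v (Suc i))"
    if "i < n" "0 \<le> y" "y \<le> 1" "Suc i = n \<or> v (Suc i) \<notin> h ` {0..<y}" for i y
  proof (rule seg(2))
    show "Suc i = n \<or> y \<le> L ! Suc i" using that L01[of "Suc i"] by (force simp: v_def)
  qed (use that in auto)
  ultimately show ?thesis by blast
qed

end

section \<open>Contour factors of compositions\<close>

context pointed_map
begin

text \<open>An interior contour point is a departure at which \<open>h\<close> is not locally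
  affine. Asking for affinity at departures only is what makes compositions accessible to this
  criterion.\<close>

lemma finite_contour_points:
  assumes "finite B" "\<And>\<alpha>. 0 < \<alpha> \<Longrightarrow> \<alpha> < 1 \<Longrightarrow> \<alpha> \<notin> B \<Longrightarrow> departure h \<alpha> \<Longrightarrow> affine_near h \<alpha>"
  shows "finite {\<alpha>. contour_point h \<alpha>}"
proof (rule finite_subset)
  interpret n: pointed_map "\<lambda>x. - h x" by (rule uminus)
  show "{\<alpha>. contour_point h \<alpha>} \<subseteq> insert 1 B"
  proof (rule subsetI, rule ccontr)
    fix \<alpha> assume a: "\<alpha> \<in> {\<alpha>. contour_point h \<alpha>}" "\<alpha> \<notin> insert 1 B"
    then have d: "departure h \<alpha>" and c: "contour_point h \<alpha>" by (auto simp: contour_point_def)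
    then have 1: "0 < \<alpha>" "\<alpha> < 1" using a(2) by (auto simp: departure_def less_le)
    have aff: "affine_near h \<alpha>" using assms(2)[of \<alpha>] a 1 d by auto
    have "affine_near (\<lambda>x. - h x) \<alpha>"
      using affine_near_compose[OF affine_near_uminus aff] by (simp add: o_def)
    then show False
      using departure_cases[OF d] aff not_affine_near_contour_point[OF c] c 1
        n.not_affine_near_contour_point[of \<alpha>, unfolded contour_point_uminus positive_departure_uminus]
      by blast
  qed
qed (use assms(1) in simp)

end

locale folding_data =
  fixes f g :: "real \<Rightarrow> real"
  assumes plf: "piecewise_linear_on (-1) 1 f" and plg: "piecewise_linear_on (-1) 1 g"
    and f0: "f 0 = 0" and g0: "g 0 = 0" and rf: "f \<in> {-1..1} \<rightarrow> {-1..1}" and rg: "g \<in> {-1..1} \<rightarrow> {-1..1}"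
    and ncf: "\<not> f constant_on {-1..0}"
    and ncfg: "\<not> (f \<circ> g) constant_on {-1..0}"
    and eq: "\<And>y. 0 < y \<Longrightarrow> y \<le> 1 \<Longrightarrow> contour_factor (f \<circ> uminus) y = contour_factor (f \<circ> g \<circ> uminus) y"
begin

lemma cf: "continuous_on {-1..1} f" and cg: "continuous_on {-1..1} g"
  using plf plg by (auto simp: piecewise_linear_on_def)

lemma constant_on_uminus: "(h \<circ> uminus) constant_on {0..1::real} \<Longrightarrow> h constant_on {-1..0::real}"
  unfolding constant_on_def o_def
  by (metis atLeastAtMost_iff minus_minus neg_0_le_iff_le neg_le_iff_le)

lemma pointed_f: "pointed_map (f \<circ> uminus)"
proof
  show "continuous_on {0..1} (f \<circ> uminus)"
    unfolding o_def by (intro continuous_on_compose2[OF cf] continuous_intros) auto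
qed (simp add: f0)

lemma pointed_fg: "pointed_map (f \<circ> g \<circ> uminus)"
proof
  show "continuous_on {0..1} (f \<circ> g \<circ> uminus)"
    unfolding o_def
    by (intro continuous_on_compose2[OF cf] continuous_on_compose2[OF cg] continuous_intros) (use rg in auto)
qed (simp add: f0 g0)

lemma finite_f: "finite {\<alpha>. contour_point (f \<circ> uminus) \<alpha>}"
proof -
  obtain B where B: "finite B" "\<And>x. x \<in> {-1<..<1} - B \<Longrightarrow> affine_near f x"
    using piecewise_linear_on_affine_near[OF plf] by blast
  show ?thesis
  proof (rule pointed_map.finite_contour_points[OF pointed_f, of "uminus ` B"])
    show "affine_near (f \<circ> uminus) \<alpha>" if "0 < \<alpha>" "\<alpha> < 1" "\<alpha> \<notin> uminus ` B" for \<alpha>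
      using that by (intro affine_near_compose affine_near_uminus B) (auto simp: image_def)
  qed (use B in simp)
qed

text \<open>A composition may have further breakpoints where \<open>g\<close> meets a breakpoint of \<open>f\<close>, but distinct
  departures of \<open>f \<circ> g\<close> have distinct \<open>g\<close>-values, so only finitely many of these are departures.\<close>

lemma finite_fg: "finite {\<alpha>. contour_point (f \<circ> g \<circ> uminus) \<alpha>}"
proof -
  obtain B where B: "finite B" "\<And>x. x \<in> {-1<..<1} - B \<Longrightarrow> affine_near f x"
    using piecewise_linear_on_affine_near[OF plf] by blast
  obtain B' where B': "finite B'" "\<And>x. x \<in> {-1<..<1} - B' \<Longrightarrow> affine_near g x"
    using piecewise_linear_on_affine_near[OF plg] by blast
  define D where "D = {\<alpha>. departure (f \<circ> g \<circ> uminus) \<alpha> \<and> g (- \<alpha>) \<in> insert 1 (insert (-1) B)}"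
  have False if "\<alpha> \<in> D" "\<beta> \<in> D" "g (- \<alpha>) = g (- \<beta>)" "\<alpha> < \<beta>" for \<alpha> \<beta>
  proof -
    have "(f \<circ> g \<circ> uminus) \<beta> \<in> (f \<circ> g \<circ> uminus) ` {0..<\<beta>}"
      using that by (intro image_eqI[of _ _ \<alpha>]) (auto simp: D_def departure_def)
    then show False using that by (auto simp: D_def departure_def)
  qed
  then have "inj_on (\<lambda>\<alpha>. g (- \<alpha>)) D" by (intro inj_onI) (metis linorder_less_linear)
  moreover have "(\<lambda>\<alpha>. g (- \<alpha>)) ` D \<subseteq> insert 1 (insert (-1) B)" by (auto simp: D_def)
  ultimately have fD: "finite D" using B by (meson finite_imageD finite_insert finite_subset)
  show ?thesis
  proof (rule pointed_map.finite_contour_points[OF pointed_fg, of "uminus ` B' \<union> D"])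
    show "affine_near (f \<circ> g \<circ> uminus) \<alpha>"
      if "0 < \<alpha>" "\<alpha> < 1" "\<alpha> \<notin> uminus ` B' \<union> D" "departure (f \<circ> g \<circ> uminus) \<alpha>" for \<alpha>
    proof -
      have "g (- \<alpha>) \<in> {-1..1}" using rg that by auto
      moreover have "g (- \<alpha>) \<notin> insert 1 (insert (-1) B)" using that by (auto simp: D_def)
      ultimately have "g (- \<alpha>) \<in> {-1<..<1} - B" by auto
      moreover have "- \<alpha> \<in> {-1<..<1} - B'" using that by (auto simp: image_def)
      ultimately show ?thesis
        by (intro affine_near_compose affine_near_uminus B B') auto
    qed
  qed (use B' fD in auto)
qed

text \<open>\<open>S\<close> is the lift of the left half of \<open>f\<close> through its own
  contour factor. The last node is a value of \<open>f\<close>, so \<open>S\<close> attains 1 and is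
  onto; \<open>fold_fg\<close> relies on this.\<close>

lemma fold_f:
  "continuous_on {0..1} (contour_factor (f \<circ> uminus))"
  "contour_factor (f \<circ> uminus) \<in> {0..1} \<rightarrow> {-1..1}"
  "contour_factor (f \<circ> uminus) 0 = 0"
  "\<exists>S. continuous_on {0..1} S \<and> S \<in> {0..1} \<rightarrow> {0..1} \<and> S 0 = 0 \<and> 1 \<in> S ` {0..1} \<and>
    (\<forall>x\<in>{0..1}. contour_factor (f \<circ> uminus) (S x) = f (- x))"
proof -
  have nc: "\<not> (f \<circ> uminus) constant_on {0..1}" using ncf constant_on_uminus by blast
  obtain n v where z: "zigzag n v (contour_factor (f \<circ> uminus))" "\<forall>i\<le>n. v i \<in> (f \<circ> uminus) ` {0..1}"
    "\<And>i y. \<lbrakk>i < n; 0 \<le> y; y \<le> 1; Suc i = n \<or> v (Suc i) \<notin> (f \<circ> uminus) ` {0..<y}\<rbrakk>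
      \<Longrightarrow> (f \<circ> uminus) y \<in> closed_segment (v i) (v (Suc i))"
    using pointed_map.contour_zigzag[OF pointed_f finite_f nc] by blast
  interpret z: zigzag n v "contour_factor (f \<circ> uminus)" by (rule z)
  have "\<bar>v i\<bar> \<le> 1" if i: "i \<le> n" for i
  proof -
    obtain x where "x \<in> {0..1}" "v i = f (- x)" using z(2) i by auto
    then show ?thesis using funcset_mem[OF rf, of "- x"] by (auto simp: abs_le_iff)
  qed
  then have "\<bar>contour_factor (f \<circ> uminus) y\<bar> \<le> 1" if "0 \<le> y" "y \<le> 1" for y
    using z.T_bounds that by blast
  then show "contour_factor (f \<circ> uminus) \<in> {0..1} \<rightarrow> {-1..1}" by (auto simp: abs_le_iff minus_le_iff)
  show "continuous_on {0..1} (contour_factor (f \<circ> uminus))" by (rule z.continuous_T)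
  show "contour_factor (f \<circ> uminus) 0 = 0" by (rule z.T_0)
  show "\<exists>S. continuous_on {0..1} S \<and> S \<in> {0..1} \<rightarrow> {0..1} \<and> S 0 = 0 \<and> 1 \<in> S ` {0..1} \<and>
    (\<forall>x\<in>{0..1}. contour_factor (f \<circ> uminus) (S x) = f (- x))"
    using z.lift[OF pointed_map.cont[OF pointed_f] pointed_map.h0[OF pointed_f] z(3)] z(2) by auto
qed

text \<open>The map \<open>f \<circ> T'\<close> becomes \<open>f \<circ> g \<circ> uminus\<close>
  after \<open>S'\<close>, which is onto and fixes 0. So it meets the nodes of
  \<open>f \<circ> g\<close> in the same order and lifts through the contour factor of
  \<open>f \<circ> g\<close>, which is that of \<open>f\<close>.\<close>

lemma fold_fg:
  fixes T' S' :: "real \<Rightarrow> real"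
  assumes T': "continuous_on {0..1} T'" "T' \<in> {0..1} \<rightarrow> {-1..1}" "T' 0 = 0"
    and S': "continuous_on {0..1} S'" "S' \<in> {0..1} \<rightarrow> {0..1}" "S' 0 = 0" "1 \<in> S' ` {0..1}"
    and T'S': "\<And>x. x \<in> {0..1} \<Longrightarrow> T' (S' x) = g (- x)"
  shows "\<exists>M. continuous_on {0..1} M \<and> M \<in> {0..1} \<rightarrow> {0..1} \<and> M 0 = 0 \<and>
    (\<forall>y\<in>{0..1}. contour_factor (f \<circ> uminus) (M y) = f (T' y))"
proof -
  have nc: "\<not> (f \<circ> g \<circ> uminus) constant_on {0..1}" using ncfg constant_on_uminus by blast
  obtain n v where z: "zigzag n v (contour_factor (f \<circ> g \<circ> uminus))"
    "\<And>i y. \<lbrakk>i < n; 0 \<le> y; y \<le> 1; Suc i = n \<or> v (Suc i) \<notin> (f \<circ> g \<circ> uminus) ` {0..<y}\<rbrakk>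
      \<Longrightarrow> (f \<circ> g \<circ> uminus) y \<in> closed_segment (v i) (v (Suc i))"
    using pointed_map.contour_zigzag[OF pointed_fg finite_fg nc] by blast
  interpret z: zigzag n v "contour_factor (f \<circ> g \<circ> uminus)" by (rule z)
  \<comment> \<open>The first time at which \<open>S'\<close> reaches \<open>y\<close>: up to then
    it stays below \<open>y\<close>, so values not yet taken by \<open>f \<circ> T'\<close> before
    \<open>y\<close> are not yet taken by \<open>f \<circ> g \<circ> uminus\<close> before
    \<open>x\<close>.\<close>
  have onto: "\<exists>x\<in>{0..1}. S' x = y \<and> S' ` {0..<x} \<subseteq> {0..<y}" if y: "0 \<le> y" "y \<le> 1" for y
  proof -
    obtain w where w: "0 \<le> w" "w \<le> 1" "S' w = 1" using S' by auto
    have "\<exists>x\<ge>0. x \<le> w \<and> S' x = y"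
      using w y S' by (intro IVT'[of S' 0 y w] continuous_on_subset[OF S'(1)]) auto
    then have "y \<in> S' ` {0..1}" using w by (auto intro: order.trans)
    then obtain x where x: "0 \<le> x" "x \<le> 1" "S' x = y" "\<And>z. 0 \<le> z \<Longrightarrow> z < x \<Longrightarrow> S' z \<noteq> y"
      using first_hit[OF S'(1)] by blast
    have "S' z \<in> {0..<y}" if z: "0 \<le> z" "z < x" for z
    proof (rule ccontr)
      have "S' z \<ge> 0" using S'(2) z x by auto
      moreover assume "S' z \<notin> {0..<y}"
      ultimately have "y \<le> S' z" by auto
      then have "\<exists>z'\<ge>0. z' \<le> z \<and> S' z' = y"
        using y z x S' by (intro IVT'[of S' 0 y z] continuous_on_subset[OF S'(1)]) auto
      then obtain z' where "0 \<le> z'" "z' \<le> z" "S' z' = y" by blast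
      then show False using x(4)[of z'] z by simp
    qed
    then show ?thesis using x by (intro bexI[of _ x]) auto
  qed
  have "\<exists>M. continuous_on {0..1} M \<and> M \<in> {0..1} \<rightarrow> {0..1} \<and> M 0 = 0 \<and>
    (\<forall>y\<in>{0..1}. contour_factor (f \<circ> g \<circ> uminus) (M y) = (f \<circ> T') y) \<and> (v n \<in> (f \<circ> T') ` {0..1} \<longrightarrow> 1 \<in> M ` {0..1})"
  proof (rule z.lift)
    show "continuous_on {0..1} (f \<circ> T')"
      using T' by (intro continuous_on_compose T' continuous_on_subset[OF cf]) auto
    show "(f \<circ> T') 0 = 0" using f0 T' by simp
    fix i y assume i: "i < n" "0 \<le> y" "y \<le> 1" "Suc i = n \<or> v (Suc i) \<notin> (f \<circ> T') ` {0..<y}"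
    obtain x where x: "x \<in> {0..1}" "S' x = y" "S' ` {0..<x} \<subseteq> {0..<y}" using onto[OF i(2,3)] by blast
    have hx: "(f \<circ> g \<circ> uminus) w = (f \<circ> T') (S' w)" if "w \<in> {0..1}" for w using T'S'[OF that] by simp
    have "(f \<circ> g \<circ> uminus) ` {0..<x} \<subseteq> (f \<circ> T') ` (S' ` {0..<x})"
      unfolding image_image using hx x(1) by (intro equalityD1 image_cong) auto
    also have "\<dots> \<subseteq> (f \<circ> T') ` {0..<y}" using x(3) by (rule image_mono)
    finally have "(f \<circ> g \<circ> uminus) ` {0..<x} \<subseteq> (f \<circ> T') ` {0..<y}" .
    then have "(f \<circ> g \<circ> uminus) x \<in> closed_segment (v i) (v (Suc i))"
      using i x by (intro z(2)) auto
    then show "(f \<circ> T') y \<in> closed_segment (v i) (v (Suc i))" using hx[OF x(1)] x(2) by simp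
  qed
  then obtain M where M: "continuous_on {0..1} M" "M \<in> {0..1} \<rightarrow> {0..1}" "M 0 = 0"
    "\<And>y. y \<in> {0..1} \<Longrightarrow> contour_factor (f \<circ> g \<circ> uminus) (M y) = f (T' y)"
    by auto
  \<comment> \<open>At 0 the radial contour factor is read off from the right half, so there the
    equality comes from both zigzags starting at 0.\<close>
  have "contour_factor (f \<circ> uminus) y = contour_factor (f \<circ> g \<circ> uminus) y" if "y \<in> {0..1}" for y
    using eq[of y] fold_f(3) z.T_0 that by (cases "y = 0") auto
  then have "contour_factor (f \<circ> uminus) (M y) = f (T' y)" if "y \<in> {0..1}" for y
    using M(4)[OF that] funcset_mem[OF M(2) that] by simp
  then show ?thesis using M by (intro exI[of _ M]) auto
qed

end

section \<open>Folded bonding maps\<close>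

locale folded =
  fixes f T S M :: "nat \<Rightarrow> real \<Rightarrow> real"
  assumes f_cont: "continuous_on {-1..1} (f n)" and f_range: "f n \<in> {-1..1} \<rightarrow> {-1..1}" and f_0: "f n 0 = 0"
    and T_cont: "continuous_on {0..1} (T n)" and T_range: "T n \<in> {0..1} \<rightarrow> {-1..1}" and T_0: "T n 0 = 0"
    and S_cont: "continuous_on {0..1} (S n)" and S_range: "S n \<in> {0..1} \<rightarrow> {0..1}" and S_0: "S n 0 = 0"
    and M_cont: "continuous_on {0..1} (M n)" and M_range: "M n \<in> {0..1} \<rightarrow> {0..1}" and M_0: "M n 0 = 0"
    and TS: "x \<in> {0..1} \<Longrightarrow> T n (S n x) = f n (- x)"
    and TM: "y \<in> {0..1} \<Longrightarrow> T n (M n y) = f n (T (Suc n) y)"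
begin

text \<open>\<open>bond d n\<close> is \<open>f\<^sub>n \<circ> \<dots> \<circ> f\<^bsub>n+d\<^esub>\<close>, and \<open>\<theta> d n\<close> lifts it through \<open>q n\<close>.\<close>

primrec bond :: "nat \<Rightarrow> nat \<Rightarrow> real \<Rightarrow> real" where
  "bond 0 n x = f n x"
| "bond (Suc d) n x = f n (bond d (Suc n) x)"

primrec lift :: "nat \<Rightarrow> nat \<Rightarrow> real \<Rightarrow> real" where
  "lift 0 n x = S n x"
| "lift (Suc d) n x = M n (lift d (Suc n) x)"

primrec \<theta> :: "nat \<Rightarrow> nat \<Rightarrow> real \<Rightarrow> real" where
  "\<theta> 0 n x = (if x \<le> 0 then - lift 0 n (- x) else x)"
| "\<theta> (Suc d) n x = (if x \<le> 0 then - lift (Suc d) n (- x) else \<theta> d n (f (Suc (n + d)) x))"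

definition q :: "nat \<Rightarrow> real \<Rightarrow> real" where
  "q n z = (if z \<le> 0 then T n (- z) else f n z)"

declare bond.simps [simp del] lift.simps [simp del] \<theta>.simps [simp del]

text \<open>The recursion for \<open>bond\<close> adds a map on the outside, whereas
  \<open>\<theta>\<close> is extended on the inside; this identity mediates between the two.\<close>

lemma bond_Suc: "bond (Suc d) n x = bond d n (f (Suc (n + d)) x)"
  by (induction d arbitrary: n) (auto simp: bond.simps)

lemma lift_range: "x \<in> {0..1} \<Longrightarrow> lift d n x \<in> {0..1}"
  by (induction d arbitrary: n) (auto simp: lift.simps simp del: atLeastAtMost_iff intro!: funcset_mem[OF S_range] funcset_mem[OF M_range])

lemma lift_0: "lift d n 0 = 0"
  by (induction d arbitrary: n) (auto simp: S_0 M_0 lift.simps)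

lemma lift_cont: "continuous_on {0..1} (lift d n)"
proof (induction d arbitrary: n)
  case 0
  have "lift 0 n = S n" by (simp add: lift.simps fun_eq_iff)
  then show ?case using S_cont by simp
next
  case (Suc d)
  have "continuous_on {0..1} (\<lambda>x. M n (lift d (Suc n) x))"
    by (intro continuous_on_compose2[OF M_cont Suc]) (use lift_range in blast)
  moreover have "lift (Suc d) n = (\<lambda>x. M n (lift d (Suc n) x))" by (simp add: lift.simps fun_eq_iff)
  ultimately show ?case by simp
qed

lemma T_lift: "x \<in> {0..1} \<Longrightarrow> T n (lift d n x) = bond d n (- x)"
proof (induction d arbitrary: n)
  case (Suc d)
  then show ?case using TM[OF lift_range[OF Suc.prems]] by (simp add: lift.simps bond.simps)
qed (simp add: TS lift.simps bond.simps)

lemma \<theta>_left: "x \<le> 0 \<Longrightarrow> \<theta> d n x = - lift d n (- x)"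
  by (cases d) (auto simp: \<theta>.simps)

lemma \<theta>_0: "\<theta> d n 0 = 0"
  by (simp add: \<theta>_left lift_0)

text \<open>The gain from folding: a positive value of \<open>\<theta> d n\<close> can only be taken
  at a positive argument.\<close>

lemma \<theta>_nonpos: "x \<in> {-1..0} \<Longrightarrow> \<theta> d n x \<le> 0"
  using lift_range[of "- x" d n] by (simp add: \<theta>_left)

lemma \<theta>_Suc: "x \<in> {0..1} \<Longrightarrow> \<theta> (Suc d) n x = \<theta> d n (f (Suc (n + d)) x)"
  by (cases "x = 0") (auto simp: \<theta>_0 f_0 \<theta>.simps(2) lift_0)

lemma \<theta>_range: "\<theta> d n \<in> {-1..1} \<rightarrow> {-1..1}"
proof
  fix x :: real assume x: "x \<in> {-1..1}"
  show "\<theta> d n x \<in> {-1..1}"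
  proof (cases "x \<le> 0")
    case True
    then show ?thesis using lift_range[of "- x" d n] x by (auto simp: \<theta>_left)
  next
    case False
    then have "x \<in> {0..1}" using x by auto
    then show ?thesis
    proof (induction d arbitrary: x)
      case (Suc d)
      have "f (Suc (n + d)) x \<in> {-1..1}" using f_range[of "Suc (n + d)"] Suc.prems by (auto simp: Pi_iff)
      then show ?case
        using Suc.IH[of "f (Suc (n + d)) x"] lift_range[of "- f (Suc (n + d)) x" d n] Suc.prems
        by (cases "f (Suc (n + d)) x \<le> 0") (auto simp: \<theta>_Suc \<theta>_left)
    qed (auto simp: \<theta>.simps lift_0)
  qed
qed

lemma cont_glue:
  fixes a b :: "real \<Rightarrow> real"
  assumes "continuous_on {0..1} a" "continuous_on {0..1} b" "a 0 = b 0"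
  shows "continuous_on {-1..1} (\<lambda>x. if x \<le> 0 then a (- x) else b x)"
proof -
  have "continuous_on ({-1..0} \<union> {0..1}) (\<lambda>x. if x \<le> 0 then a (- x) else b x)"
    by (intro continuous_on_If continuous_on_compose2[OF assms(1)] continuous_intros assms(2)) (use assms(3) in auto)
  moreover have "{-1..0} \<union> {0..1} = {-1..1::real}" by auto
  ultimately show ?thesis by simp
qed

lemma \<theta>_cont: "continuous_on {-1..1} (\<theta> d n)"
proof (induction d)
  case 0
  have "continuous_on {-1..1} (\<lambda>x. if x \<le> 0 then - lift 0 n (- x) else x)"
  proof (rule cont_glue[of "\<lambda>x. - lift 0 n x"])
    show "continuous_on {0..1} (\<lambda>x. - lift 0 n x)" by (intro continuous_intros lift_cont)
  qed (auto simp: lift_0 continuous_on_id)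
  moreover have "\<theta> 0 n = (\<lambda>x. if x \<le> 0 then - lift 0 n (- x) else x)" by (simp add: \<theta>.simps fun_eq_iff)
  ultimately show ?case by simp
next
  case (Suc d)
  have "continuous_on {-1..1} (\<lambda>x. if x \<le> 0 then - lift (Suc d) n (- x) else \<theta> d n (f (Suc (n + d)) x))"
  proof (rule cont_glue[of "\<lambda>x. - lift (Suc d) n x"])
    show "continuous_on {0..1} (\<lambda>x. - lift (Suc d) n x)" by (intro continuous_intros lift_cont)
    show "continuous_on {0..1} (\<lambda>x. \<theta> d n (f (Suc (n + d)) x))"
      by (intro continuous_on_compose2[OF Suc] continuous_on_subset[OF f_cont])
        (use f_range[of "Suc (n + d)"] in auto)
    show "- lift (Suc d) n 0 = \<theta> d n (f (Suc (n + d)) 0)" by (simp add: lift_0 f_0 \<theta>_0)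
  qed
  moreover have "\<theta> (Suc d) n = (\<lambda>x. if x \<le> 0 then - lift (Suc d) n (- x) else \<theta> d n (f (Suc (n + d)) x))"
    by (simp add: \<theta>.simps fun_eq_iff)
  ultimately show ?case by simp
qed

lemma q_0: "q n 0 = 0" by (simp add: q_def T_0)

lemma q_range: "q n \<in> {-1..1} \<rightarrow> {-1..1}"
  using T_range[of n] f_range[of n] by (auto simp: q_def Pi_iff)

lemma q_cont: "continuous_on {-1..1} (q n)"
  unfolding q_def
  by (rule cont_glue[OF T_cont]) (auto simp: T_0 f_0 intro: continuous_on_subset[OF f_cont])

lemma q_\<theta>: "x \<in> {-1..1} \<Longrightarrow> q n (\<theta> d n x) = bond d n x"
proof (cases "x \<le> 0")
  case True
  moreover assume "x \<in> {-1..1}"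
  ultimately have "- x \<in> {0..1}" by simp
  then show ?thesis using T_lift[of "- x" n d] lift_range[of "- x" d n] True by (simp add: \<theta>_left q_def)
next
  case False
  moreover assume "x \<in> {-1..1}"
  ultimately have "x \<in> {0..1}" by simp
  then show ?thesis
  proof (induction d arbitrary: x)
    case 0
    then show ?case by (auto simp: \<theta>.simps bond.simps lift_0 q_def T_0 f_0)
  next
    case (Suc d)
    define z where "z = f (Suc (n + d)) x"
    have z: "z \<in> {-1..1}" using f_range[of "Suc (n + d)"] Suc.prems by (auto simp: Pi_iff z_def)
    have "q n (\<theta> d n z) = bond d n z"
    proof (cases "z \<le> 0")
      case True
      then have "- z \<in> {0..1}" using z by simp
      then show ?thesis using T_lift[of "- z" n d] lift_range[of "- z" d n] True by (simp add: \<theta>_left q_def)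
    qed (use Suc.IH[of z] z in auto)
    then show ?case using \<theta>_Suc[OF Suc.prems] by (simp add: bond_Suc z_def)
  qed
qed

text \<open>Bonding map of the folded system from level \<open>Suc (n + d)\<close> to level
  \<open>n\<close>: \<open>q\<close> returns to the ordinary coordinate at the source,
  \<open>\<theta>\<close> folds on the way to the target.\<close>

definition g :: "nat \<Rightarrow> nat \<Rightarrow> real \<Rightarrow> real" where
  "g d n z = \<theta> d n (q (Suc (n + d)) z)"

lemma g_cont: "continuous_on {-1..1} (g d n)"
  unfolding g_def using q_range by (intro continuous_on_compose2[OF \<theta>_cont q_cont]) auto

lemma g_range: "g d n \<in> {-1..1} \<rightarrow> {-1..1}"
  unfolding g_def using q_range \<theta>_range by (auto simp: Pi_iff)

lemma g_0: "g d n 0 = 0" by (simp add: g_def q_0 \<theta>_0)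

section \<open>Finiteness of violations\<close>

definition violation :: "real \<Rightarrow> nat \<Rightarrow> nat \<Rightarrow> bool" where
  "violation \<epsilon> n d \<longleftrightarrow> (\<exists>x y s t. -1 \<le> x \<and> x \<le> t \<and> t \<le> 0 \<and> 0 \<le> s \<and> s \<le> y \<and> y \<le> 1 \<and>
     (\<forall>t'. x \<le> t' \<longrightarrow> t' \<le> 0 \<longrightarrow> g d n s < g d n t' - \<epsilon>) \<and> (\<forall>s'. 0 \<le> s' \<longrightarrow> s' \<le> y \<longrightarrow> g d n s' < g d n t - \<epsilon>))"

text \<open>For a fixed pair \<open>p\<close> of thresholds, \<open>Q p d\<close> can only be lost
  as \<open>d\<close> grows, hence is lost at most once. Each violating \<open>d\<close> is the
  moment of loss for some pair in a finite grid, so different violating \<open>d\<close> use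
  different pairs.\<close>

lemma finite_violations:
  assumes e: "0 < \<epsilon>"
  shows "finite {d. violation \<epsilon> n d}"
proof -
  \<comment> \<open>A race between an upper and a lower threshold along the right half. The
    condition \<open>1 \<le> j\<close> makes the target positive, so that only a positive argument
    can attain it.\<close>
  define Q where "Q = (\<lambda>(i::int, j::int) d. 1 \<le> j \<and> (\<exists>b. 0 \<le> b \<and> b \<le> 1 \<and> \<epsilon> * j \<le> \<theta> d n b \<and> (\<forall>z. 0 \<le> z \<longrightarrow> z \<le> b \<longrightarrow> \<epsilon> * i < \<theta> d n z)))"
  have Q_Suc: "Q p d" if Q: "Q p (Suc d)" for p d
  proof -
    obtain i j where p: "p = (i, j)" by fastforce
    obtain b where b: "1 \<le> j" "0 \<le> b" "b \<le> 1" "\<epsilon> * j \<le> \<theta> (Suc d) n b" "\<And>z. 0 \<le> z \<Longrightarrow> z \<le> b \<Longrightarrow> \<epsilon> * i < \<theta> (Suc d) n z"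
      using Q p unfolding Q_def by auto
    define b' where "b' = f (Suc (n + d)) b"
    have b': "b' \<in> {-1..1}" using f_range[of "Suc (n + d)"] b by (auto simp: b'_def)
    have th: "\<theta> d n b' = \<theta> (Suc d) n b" unfolding b'_def using b \<theta>_Suc[of b d n] by simp
    have "0 < \<epsilon> * j" using e b(1) by simp
    then have "0 < \<theta> d n b'" using th b by linarith
    \<comment> \<open>The image of \<open>{0..b}\<close> under the next map is connected and
      contains 0 and \<open>b'\<close>; as \<open>b'\<close> is positive, it covers
      \<open>{0..b'}\<close>.\<close>
    then have pos: "0 < b'" using \<theta>_nonpos[of b' d n] b' by force
    have "\<epsilon> * i < \<theta> d n z" if z: "0 \<le> z" "z \<le> b'" for z
    proof -
      have "continuous_on {0..b} (f (Suc (n + d)))" using b by (intro continuous_on_subset[OF f_cont]) auto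
      then obtain z' where "0 \<le> z'" "z' \<le> b" "f (Suc (n + d)) z' = z"
        using IVT'[of "f (Suc (n + d))" 0 z b] z b f_0 unfolding b'_def by auto
      then show ?thesis using b(5)[of z'] \<theta>_Suc[of z' d n] b by auto
    qed
    then show ?thesis using b b' th pos unfolding p Q_def by (auto intro!: exI[of _ b'])
  qed
  define K where "K = \<lceil>1 / \<epsilon>\<rceil>"
  have "\<exists>p\<in>{-K..K} \<times> {-K..K}. Q p d \<and> \<not> Q p (Suc d)" if V: "violation \<epsilon> n d" for d
  proof -
    obtain x y s t where xy: "-1 \<le> x" "x \<le> t" "t \<le> 0" "0 \<le> s" "s \<le> y" "y \<le> 1"
      and 1: "\<And>t'. x \<le> t' \<Longrightarrow> t' \<le> 0 \<Longrightarrow> g d n s < g d n t' - \<epsilon>"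
      and 2: "\<And>s'. 0 \<le> s' \<Longrightarrow> s' \<le> y \<Longrightarrow> g d n s' < g d n t - \<epsilon>"
      using V unfolding violation_def by blast
    \<comment> \<open>Rounding inwards costs less than \<open>\<epsilon>\<close> on each side:
      values above \<open>g d n s + \<epsilon>\<close> exceed \<open>\<epsilon> * i\<close>, and
      values below \<open>g d n t - \<epsilon>\<close> stay under
      \<open>\<epsilon> * j\<close>.\<close>
    define i where "i = \<lceil>g d n s / \<epsilon>\<rceil>"
    define j where "j = \<lfloor>g d n t / \<epsilon>\<rfloor>"
    have "g d n s / \<epsilon> \<le> i" "i < g d n s / \<epsilon> + 1" "j \<le> g d n t / \<epsilon>" "g d n t / \<epsilon> < j + 1"
      unfolding i_def j_def by linarith+
    then have i: "g d n s \<le> \<epsilon> * i" "\<epsilon> * i < g d n s + \<epsilon>" and j: "\<epsilon> * j \<le> g d n t" "g d n t < \<epsilon> * j + \<epsilon>"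
      using e by (auto simp: field_simps)
    have gt: "\<epsilon> < g d n t" using 2[of 0] xy by (simp add: g_0)
    then have "\<epsilon> * 0 < \<epsilon> * j" using j by linarith
    then have j1: "1 \<le> j" using e by (auto simp: zero_less_mult_iff)
    have bd: "\<bar>g d n s\<bar> \<le> 1" "\<bar>g d n t\<bar> \<le> 1" using g_range[of d n] xy by (auto simp: Pi_iff abs_le_iff)
    have "- (1 / \<epsilon>) \<le> g d n s / \<epsilon>" "g d n s / \<epsilon> \<le> 1 / \<epsilon>" "- (1 / \<epsilon>) \<le> g d n t / \<epsilon>" "g d n t / \<epsilon> \<le> 1 / \<epsilon>"
      using bd e by (auto simp: abs_le_iff field_simps)
    then have K: "i \<in> {-K..K}" "j \<in> {-K..K}" unfolding i_def j_def K_def by (auto; linarith)+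
    define k where "k = Suc (n + d)"
    \<comment> \<open>The left half of \<open>g d n\<close> runs \<open>\<theta> d n\<close> along
      the path \<open>T k\<close>, while the right half is \<open>\<theta> (Suc d) n\<close>. The
      left half therefore witnesses \<open>Q (i, j) d\<close>, and the right half refutes
      \<open>Q (i, j) (Suc d)\<close>.\<close>
    have gneg: "g d n t' = \<theta> d n (T k (- t'))" if "t' \<le> 0" for t'
      using that by (simp add: g_def q_def k_def)
    have gpos: "g d n s' = \<theta> (Suc d) n s'" if "0 \<le> s'" "s' \<le> 1" for s'
    proof -
      have "q k s' = f k s'" using that by (cases "s' = 0") (auto simp: q_def T_0 f_0)
      then show ?thesis using \<theta>_Suc[of s' d n] that by (simp add: g_def k_def)
    qed
    define b where "b = T k (- t)"
    have b1: "b \<in> {-1..1}" unfolding b_def using T_range[of k] xy by (auto simp: Pi_iff)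
    have "0 < \<theta> d n b" using gneg[of t] gt e xy by (simp add: b_def)
    then have b0: "0 < b" using \<theta>_nonpos[of b d n] b1 by force
    have path: "\<epsilon> * i < \<theta> d n z" if z: "0 \<le> z" "z \<le> b" for z
    proof -
      have "continuous_on {0..- t} (T k)" using xy by (intro continuous_on_subset[OF T_cont]) auto
      then obtain z' where z': "0 \<le> z'" "z' \<le> - t" "T k z' = z"
        using IVT'[of "T k" 0 z "- t"] z xy T_0 unfolding b_def by auto
      then show ?thesis using 1[of "- z'"] gneg[of "- z'"] i xy by auto
    qed
    have "Q (i, j) d" unfolding Q_def using j1 b0 b1 path gneg[of t] j xy by (auto simp: b_def intro!: exI[of _ b])
    moreover have "\<not> Q (i, j) (Suc d)"
    proof
      assume "Q (i, j) (Suc d)"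
      then obtain c where c: "0 \<le> c" "c \<le> 1" "\<epsilon> * j \<le> \<theta> (Suc d) n c" "\<And>z. 0 \<le> z \<Longrightarrow> z \<le> c \<Longrightarrow> \<epsilon> * i < \<theta> (Suc d) n z"
        unfolding Q_def by auto
      \<comment> \<open>An arc that stays above \<open>\<epsilon> * i\<close> ends before
        \<open>s\<close>, but up to \<open>y\<close>, which is at least \<open>s\<close>, the right
        half is below \<open>\<epsilon> * j\<close>.\<close>
      have "\<not> s \<le> c" using c(4)[of s] gpos[of s] i xy by auto
      then have "g d n c < g d n t - \<epsilon>" using 2[of c] c xy by auto
      then show False using gpos[of c] c j by auto
    qed
    ultimately show ?thesis using K by blast
  qed
  then obtain p where p: "\<And>d. violation \<epsilon> n d \<Longrightarrow> p d \<in> {-K..K} \<times> {-K..K} \<and> Q (p d) d \<and> \<not> Q (p d) (Suc d)" by metis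
  have mono: "Q r d" if "Q r d'" "d \<le> d'" for r d d'
    using that(2,1) by (induction d rule: inc_induct) (use Q_Suc in blast)+
  have "inj_on p {d. violation \<epsilon> n d}"
  proof (rule inj_onI)
    fix d d' assume *: "d \<in> {d. violation \<epsilon> n d}" "d' \<in> {d. violation \<epsilon> n d}" "p d = p d'"
    have "\<not> d < d'" using mono[of "p d'" d' "Suc d"] p[of d] p[of d'] * by auto
    moreover have "\<not> d' < d" using mono[of "p d" d "Suc d'"] p[of d] p[of d'] * by auto
    ultimately show "d = d'" by simp
  qed
  moreover have "p ` {d. violation \<epsilon> n d} \<subseteq> {-K..K} \<times> {-K..K}" using p by blast
  ultimately show ?thesis by (meson finite_SigmaI finite_atLeastAtMost_int finite_imageD finite_subset)
qed

end

section \<open>Approximating planar maps\<close>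

text \<open>On the compact set where \<open>D\<close> is at least \<open>c\<close>, the function
  \<open>W\<close> does not vanish and has a positive minimum.\<close>

lemma compact_small_dist:
  fixes D W :: "'a::topological_space \<Rightarrow> real"
  assumes K: "compact K" and D: "continuous_on K D" and W: "continuous_on K W"
    and W0: "\<And>p. p \<in> K \<Longrightarrow> 0 \<le> W p" and WD: "\<And>p. p \<in> K \<Longrightarrow> W p = 0 \<Longrightarrow> D p = 0" and c: "0 < c"
  shows "\<exists>\<mu>>0. \<forall>p\<in>K. W p \<le> \<mu> \<longrightarrow> D p < c"
proof -
  have "closedin (top_of_set K) (K \<inter> D -` {c..})" by (rule continuous_closedin_preimage[OF D]) simp
  then have C: "compact (K \<inter> D -` {c..})" using K closedin_compact by blast
  show ?thesis
  proof (cases "K \<inter> D -` {c..} = {}")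
    case True
    then show ?thesis by (intro exI[of _ 1]) (auto simp: not_le[symmetric])
  next
    case False
    obtain p where p: "p \<in> K \<inter> D -` {c..}" "\<And>y. y \<in> K \<inter> D -` {c..} \<Longrightarrow> W p \<le> W y"
      using continuous_attains_inf[OF C False continuous_on_subset[OF W]] by auto
    have "0 < W p" using W0[of p] WD[of p] p(1) c by (auto simp: less_le)
    then show ?thesis using p(2) by (intro exI[of _ "W p / 2"]) (force simp: not_le[symmetric])
  qed
qed

context folded
begin

lemma no_violation_ex:
  assumes "0 < \<epsilon>"
  shows "\<exists>d. \<not> violation \<epsilon> n d"
proof (rule ccontr)
  assume "\<not> ?thesis"
  then have "{d. violation \<epsilon> n d} = UNIV" by auto
  then show False using finite_violations[OF assms, of n] by simp
qed

text \<open>\<open>pull k n x\<close> recovers the coordinate \<open>x\<^bsub>n-k\<^esub>\<close> of a point of the inverse limit from \<open>x\<^sub>n\<close>.\<close>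

primrec pull :: "nat \<Rightarrow> nat \<Rightarrow> real \<Rightarrow> real" where
  "pull 0 n x = x"
| "pull (Suc k) n x = f (n - Suc k) (pull k n x)"

lemma pull_range: "pull k n \<in> {-1..1} \<rightarrow> {-1..1}"
  by (induction k) (use f_range in \<open>auto simp: Pi_iff\<close>)

lemma pull_cont: "continuous_on {-1..1} (pull k n)"
proof (induction k)
  case (Suc k)
  have "continuous_on {-1..1} (\<lambda>x. f (n - Suc k) (pull k n x))"
    by (intro continuous_on_compose2[OF f_cont Suc]) (use pull_range[of k n] in auto)
  then show ?case by simp
qed (simp add: continuous_on_id)

text \<open>Measures two folded coordinates through all the coordinates \<open>0, ..., n\<close>
  that they determine, since injectivity of the limit has to be read off coordinate by
  coordinate.\<close>

definition dev :: "nat \<Rightarrow> real \<times> real \<Rightarrow> real" where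
  "dev n p = (\<Sum>k\<le>n. \<bar>pull k n (q n (fst p)) - pull k n (q n (snd p))\<bar>)"

text \<open>Later stages move points by less than \<open>2 e\<close> in total, so the last two clauses survive in the limit:
  they give its injectivity and keep it off the segment.\<close>

definition stage :: "nat \<Rightarrow> nat \<Rightarrow> (real \<times> real \<Rightarrow> real \<times> real) \<Rightarrow> real \<Rightarrow> bool" where
  "stage j n \<Phi> e \<longleftrightarrow> continuous_on UNIV \<Phi> \<and> inj \<Phi> \<and> (\<forall>s\<ge>0. \<Phi> (0, - s) = (0, - s)) \<and> 0 < e \<and> j \<le> n \<and>
     (\<forall>u\<in>{-1..1}. \<forall>v\<in>{-1..1}. dist (\<Phi> (u, 0)) (\<Phi> (v, 0)) \<le> 4 * e \<longrightarrow> dev n (u, v) < 1 / real (Suc j)) \<and>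
     (\<forall>u\<in>{-1..1}. \<forall>s\<in>{0..1}. dist (\<Phi> (u, 0)) (0, - s) \<le> 4 * e \<longrightarrow> s < 1 / real (Suc j))"

text \<open>Both separation clauses come from compactness and injectivity of \<open>\<Phi>\<close>.
  For the second, \<open>(0, - s)\<close> is its own image, so a coincidence with
  \<open>\<Phi> (u, 0)\<close> forces \<open>s = 0\<close>.\<close>

lemma stage_ex:
  assumes \<Phi>: "continuous_on UNIV \<Phi>" "inj \<Phi>" "\<And>s. 0 \<le> s \<Longrightarrow> \<Phi> (0, - s) = (0, - s)" and n: "j \<le> n" and a: "0 < a"
  shows "\<exists>e\<le>a. stage j n \<Phi> e"
proof -
  have c\<Phi>: "continuous_on A (\<lambda>p. \<Phi> (h p))" if "continuous_on A h" for A and h :: "real \<times> real \<Rightarrow> real \<times> real"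
    using that by (intro continuous_on_compose2[OF \<Phi>(1)]) auto
  have "continuous_on ({-1..1} \<times> {-1..1}) (dev n)"
    unfolding dev_def
    by (intro continuous_intros continuous_on_compose2[OF pull_cont] continuous_on_compose2[OF q_cont])
      (use q_range in \<open>auto simp: Pi_iff\<close>)
  then have "\<exists>\<mu>>0. \<forall>p\<in>{-1..1} \<times> {-1..1}. dist (\<Phi> (fst p, 0)) (\<Phi> (snd p, 0)) \<le> \<mu> \<longrightarrow> dev n p < 1 / real (Suc j)"
  proof (intro compact_small_dist)
    show "dev n p = 0" if "dist (\<Phi> (fst p, 0)) (\<Phi> (snd p, 0)) = 0" for p
    proof -
      have "fst p = snd p" using that injD[OF \<Phi>(2)] by auto
      then show ?thesis by (simp add: dev_def)
    qed
  qed (auto intro!: compact_Times continuous_intros c\<Phi>)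
  then obtain \<mu> where \<mu>: "0 < \<mu>" "\<And>u v. \<lbrakk>u \<in> {-1..1}; v \<in> {-1..1}; dist (\<Phi> (u, 0)) (\<Phi> (v, 0)) \<le> \<mu>\<rbrakk> \<Longrightarrow> dev n (u, v) < 1 / real (Suc j)"
    by (metis (no_types, lifting) SigmaI fst_conv snd_conv)
  have "\<exists>\<mu>>0. \<forall>p\<in>{-1..1} \<times> {0..1}. dist (\<Phi> (fst p, 0)) (0, - snd p) \<le> \<mu> \<longrightarrow> snd p < 1 / real (Suc j)"
  proof (intro compact_small_dist)
    show "snd p = 0" if "p \<in> {-1..1} \<times> {0..1}" "dist (\<Phi> (fst p, 0)) (0, - snd p) = 0" for p
    proof -
      have "\<Phi> (fst p, 0) = \<Phi> (0, - snd p)" using that \<Phi>(3)[of "snd p"] by (simp add: mem_Times_iff)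
      then show ?thesis using injD[OF \<Phi>(2)] by fastforce
    qed
  qed (auto intro!: compact_Times continuous_intros c\<Phi>)
  then obtain \<nu> where \<nu>: "0 < \<nu>" "\<And>u s. \<lbrakk>u \<in> {-1..1}; s \<in> {0..1}; dist (\<Phi> (u, 0)) (0, - s) \<le> \<nu>\<rbrakk> \<Longrightarrow> s < 1 / real (Suc j)"
    by (metis (no_types, lifting) SigmaI fst_conv snd_conv)
  have "4 * min a (min (\<mu> / 4) (\<nu> / 4)) \<le> \<mu>" "4 * min a (min (\<mu> / 4) (\<nu> / 4)) \<le> \<nu>" by auto
  then have "stage j n \<Phi> (min a (min (\<mu> / 4) (\<nu> / 4)))"
    unfolding stage_def using \<Phi> n a \<mu> \<nu> by (auto intro: order.trans)
  then show ?thesis by (intro exI[of _ "min a (min (\<mu> / 4) (\<nu> / 4))"]) auto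
qed

text \<open>The order of choices matters: uniform continuity of \<open>\<Phi>\<close> determines
  \<open>\<epsilon>\<close>, this determines \<open>d\<close>, and the next level
  \<open>Suc (n + d)\<close> follows from it.\<close>

lemma stage_step:
  assumes st: "stage j n \<Phi> e"
  shows "\<exists>d \<Phi>' e'. stage (Suc j) (Suc (n + d)) \<Phi>' e' \<and> e' \<le> e / 2 \<and>
    (\<forall>x\<in>{-1..1}. dist (\<Phi>' (x, 0)) (\<Phi> (g d n x, 0)) \<le> e)"
proof -
  have \<Phi>: "continuous_on UNIV \<Phi>" "inj \<Phi>" "\<And>s. 0 \<le> s \<Longrightarrow> \<Phi> (0, - s) = (0, - s)" "0 < e" "j \<le> n"
    using st by (auto simp: stage_def)
  have "uniformly_continuous_on (cball 0 3) \<Phi>"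
    using \<Phi>(1) by (intro compact_uniformly_continuous continuous_on_subset[OF \<Phi>(1)]) auto
  then obtain \<delta> where \<delta>: "0 < \<delta>" "\<And>p p'. \<lbrakk>p \<in> cball 0 3; p' \<in> cball 0 3; dist p p' < \<delta>\<rbrakk> \<Longrightarrow> dist (\<Phi> p) (\<Phi> p') < e"
    unfolding uniformly_continuous_on_def using \<Phi>(4) by metis
  \<comment> \<open>\<open>planar_step\<close> errs by \<open>6 * \<epsilon>\<close>, here at most
    half of \<open>\<delta>\<close> and half of 1, so \<open>H (x, 0)\<close> also stays inside the
    ball of radius 3.\<close>
  define \<epsilon> where "\<epsilon> = min 1 \<delta> / 12"
  have \<epsilon>: "0 < \<epsilon>" "6 * \<epsilon> < \<delta>" "6 * \<epsilon> \<le> 1" using \<delta> by (auto simp: \<epsilon>_def min_def)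
  obtain d where d: "\<not> violation \<epsilon> n d" using no_violation_ex[OF \<epsilon>(1)] by blast
  have nv: False if "-1 \<le> x" "x \<le> t" "t \<le> 0" "0 \<le> s" "s \<le> y" "y \<le> 1"
    "\<And>t'. x \<le> t' \<Longrightarrow> t' \<le> 0 \<Longrightarrow> g d n s < g d n t' - \<epsilon>"
    "\<And>s'. 0 \<le> s' \<Longrightarrow> s' \<le> y \<Longrightarrow> g d n s' < g d n t - \<epsilon>" for x y s t
  proof -
    have "violation \<epsilon> n d"
      unfolding violation_def
      by (rule exI[of _ x], rule exI[of _ y], rule exI[of _ s], rule exI[of _ t]) (use that in simp)
    then show False using d by simp
  qed
  obtain H :: "real \<times> real \<Rightarrow> real \<times> real"
    where H: "continuous_on UNIV H" "inj H" "\<And>s. 0 \<le> s \<Longrightarrow> H (0, - s) = (0, - s)"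
      "\<And>x. \<bar>x\<bar> \<le> 1 \<Longrightarrow> dist (H (x, 0)) (g d n x, 0) \<le> 6 * \<epsilon>"
    by (rule planar_step[OF g_cont[of d n] g_range g_0 \<epsilon>(1)]) (rule nv, assumption+, rule that, assumption+)
  have "\<exists>e'\<le>e / 2. stage (Suc j) (Suc (n + d)) (\<Phi> \<circ> H) e'"
  proof (rule stage_ex)
    show "continuous_on UNIV (\<Phi> \<circ> H)" by (intro continuous_on_compose H continuous_on_subset[OF \<Phi>(1)]) auto
    show "inj (\<Phi> \<circ> H)" using \<Phi> H by (intro inj_compose)
  qed (use \<Phi> H in auto)
  then obtain e' where e': "e' \<le> e / 2" "stage (Suc j) (Suc (n + d)) (\<Phi> \<circ> H) e'" by blast
  moreover have "dist ((\<Phi> \<circ> H) (x, 0)) (\<Phi> (g d n x, 0)) \<le> e" if x: "x \<in> {-1..1}" for x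
  proof -
    have D: "dist (H (x, 0)) (g d n x, 0) \<le> 6 * \<epsilon>" using H(4)[of x] x by (simp add: abs_le_iff)
    have "\<bar>g d n x\<bar> \<le> 1" using funcset_mem[OF g_range x] by (auto simp: abs_le_iff)
    then have N: "norm (g d n x, 0::real) \<le> 1" by (simp add: norm_Pair)
    have "norm (H (x, 0)) \<le> norm (g d n x, 0::real) + dist (H (x, 0)) (g d n x, 0)"
      by (metis dist_norm norm_triangle_sub)
    then have "norm (H (x, 0)) \<le> 3" using N D \<epsilon> by linarith
    then show ?thesis using \<delta>(2)[of "H (x, 0)" "(g d n x, 0)"] N D \<epsilon> by simp
  qed
  ultimately show ?thesis by blast
qed

lemma stages_ex:
  "\<exists>N \<Phi> e d. \<forall>j. stage j (N j) (\<Phi> j) (e j) \<and> N (Suc j) = Suc (N j + d j) \<and> e (Suc j) \<le> e j / 2 \<and>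
    (\<forall>x\<in>{-1..1}. dist (\<Phi> (Suc j) (x, 0)) (\<Phi> j (g (d j) (N j) x, 0)) \<le> e j)"
proof -
  have "\<exists>s. \<forall>j. (case s j of (n, \<Phi>, e) \<Rightarrow> stage j n \<Phi> e) \<and>
    (case (s j, s (Suc j)) of ((n, \<Phi>, e), (n', \<Phi>', e')) \<Rightarrow>
      \<exists>d. n' = Suc (n + d) \<and> e' \<le> e / 2 \<and> (\<forall>x\<in>{-1..1}. dist (\<Phi>' (x, 0)) (\<Phi> (g d n x, 0)) \<le> e))"
    (is "\<exists>s. \<forall>j. ?P j (s j) \<and> ?Q (s j) (s (Suc j))")
  proof -
    have "\<exists>s. \<forall>j. ?P j (s j) \<and> (\<lambda>_ a b. ?Q a b) j (s j) (s (Suc j))"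
    proof (rule dependent_nat_choice)
      obtain e where "stage 0 0 id e" using stage_ex[of id 0 0 1] by auto
      then show "\<exists>x. ?P 0 x" by (intro exI[of _ "(0, id, e)"]) simp
    next
      fix x j assume "?P j x"
      moreover obtain n \<Phi> e where "x = (n, \<Phi>, e)" by (cases x) auto
      ultimately show "\<exists>y. ?P (Suc j) y \<and> ?Q x y" using stage_step[of j n \<Phi> e] by auto
    qed
    then show ?thesis by simp
  qed
  then obtain s where s: "\<forall>j. ?P j (s j) \<and> ?Q (s j) (s (Suc j))" by (rule exE)
  define N where "N = (\<lambda>j. fst (s j))"
  define \<Phi> where "\<Phi> = (\<lambda>j. fst (snd (s j)))"
  define e where "e = (\<lambda>j. snd (snd (s j)))"
  have seq: "s j = (N j, \<Phi> j, e j)" for j by (simp add: N_def \<Phi>_def e_def)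
  have "\<exists>d. N (Suc j) = Suc (N j + d) \<and> e (Suc j) \<le> e j / 2 \<and>
    (\<forall>x\<in>{-1..1}. dist (\<Phi> (Suc j) (x, 0)) (\<Phi> j (g d (N j) x, 0)) \<le> e j)" for j
    using conjunct2[OF s[rule_format, of j]] unfolding seq by simp
  then obtain d where "\<And>j. N (Suc j) = Suc (N j + d j) \<and> e (Suc j) \<le> e j / 2 \<and>
    (\<forall>x\<in>{-1..1}. dist (\<Phi> (Suc j) (x, 0)) (\<Phi> j (g (d j) (N j) x, 0)) \<le> e j)" by metis
  moreover have "stage j (N j) (\<Phi> j) (e j)" for j using conjunct1[OF s[rule_format, of j]] unfolding seq by simp
  ultimately show ?thesis by blast
qed

end

section \<open>The limit embedding\<close>

lemma compact_inverse_limit: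
  assumes f: "\<And>n. continuous_on {-1..1} (f n)"
  shows "compact (inverse_limit {-1..1} f)"
proof -
  \<comment> \<open>Each \<open>f n\<close> is continuous only on \<open>[-1, 1]\<close>; with
    clipped arguments the bonding equations are closed conditions on the whole product.\<close>
  define clip where "clip = (\<lambda>x::real. max (-1) (min 1 x))"
  have clip: "clip x \<in> {-1..1}" "x \<in> {-1..1} \<Longrightarrow> clip x = x" for x by (auto simp: clip_def)
  have "continuous_on UNIV clip" unfolding clip_def by (intro continuous_intros)
  then have "continuous_on UNIV (\<lambda>x::nat \<Rightarrow> real. clip (x k))" for k
    by (rule continuous_on_compose2[OF _ continuous_on_product_coordinates]) simp
  then have cc: "continuous_on UNIV (\<lambda>x::nat \<Rightarrow> real. f n (clip (x k)))" for n k
    by (rule continuous_on_compose2[OF f]) (use clip in auto)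
  have "closed (\<Inter>n. {x. f n (clip (x (Suc n))) = x n})"
    by (intro closed_INT ballI closed_Collect_eq cc) simp
  moreover have "compact (PiE UNIV (\<lambda>_::nat. {-1..1::real}))"
  proof -
    have "compactin (product_topology (\<lambda>_. euclidean) UNIV) (PiE UNIV (\<lambda>_::nat. {-1..1::real}))"
      unfolding compactin_PiE by simp
    then show ?thesis by (simp add: euclidean_product_topology)
  qed
  ultimately have "compact (PiE UNIV (\<lambda>_::nat. {-1..1::real}) \<inter> (\<Inter>n. {x. f n (clip (x (Suc n))) = x n}))"
    by (rule compact_Int_closed[rotated])
  moreover have "PiE UNIV (\<lambda>_::nat. {-1..1::real}) \<inter> (\<Inter>n. {x. f n (clip (x (Suc n))) = x n}) = inverse_limit {-1..1} f"
    unfolding inverse_limit_def using clip(2) by (auto simp: PiE_UNIV_domain Pi_iff)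
  ultimately show ?thesis by simp
qed

context folded
begin

text \<open>Folded coordinate at level \<open>n\<close> of a point of the inverse limit. The
  parameter \<open>d\<close> matches that of \<open>g d n\<close>: it is the jump to the next level
  in use.\<close>

definition \<zeta> :: "nat \<Rightarrow> nat \<Rightarrow> (nat \<Rightarrow> real) \<Rightarrow> real" where
  "\<zeta> d n x = \<theta> d n (x (Suc (n + d)))"

lemma inverse_limit_mem:
  assumes "x \<in> inverse_limit {-1..1} f"
  shows "x n \<in> {-1..1}" "f n (x (Suc n)) = x n"
  using assms by (auto simp: inverse_limit_def)

lemma bond_inverse_limit: "x \<in> inverse_limit {-1..1} f \<Longrightarrow> bond d n (x (Suc (n + d))) = x n"
  by (induction d) (simp_all add: bond.simps(1) bond_Suc inverse_limit_mem)

lemma pull_inverse_limit: "x \<in> inverse_limit {-1..1} f \<Longrightarrow> k \<le> n \<Longrightarrow> pull k n (x n) = x (n - k)"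
proof (induction k)
  case (Suc k)
  then have "pull (Suc k) n (x n) = f (n - Suc k) (x (Suc (n - Suc k)))" by (simp add: Suc_diff_Suc)
  then show ?case using inverse_limit_mem(2)[OF Suc.prems(1)] by simp
qed simp

lemma \<zeta>_range: "x \<in> inverse_limit {-1..1} f \<Longrightarrow> \<zeta> d n x \<in> {-1..1}"
  unfolding \<zeta>_def using \<theta>_range inverse_limit_mem by (auto simp: Pi_iff)

lemma q_\<zeta>: "x \<in> inverse_limit {-1..1} f \<Longrightarrow> q n (\<zeta> d n x) = x n"
  by (simp add: \<zeta>_def q_\<theta> inverse_limit_mem bond_inverse_limit del: atLeastAtMost_iff)

text \<open>\<open>q\<close> recovers the ordinary coordinate from the folded one whatever
  \<open>d'\<close> is, so the size of the following jump does not matter.\<close>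

lemma g_\<zeta>: "x \<in> inverse_limit {-1..1} f \<Longrightarrow> g d n (\<zeta> d' (Suc (n + d)) x) = \<zeta> d n x"
  by (simp add: g_def q_\<zeta>) (simp add: \<zeta>_def)

lemma \<zeta>_cont: "continuous_on (inverse_limit {-1..1} f) (\<zeta> d n)"
  unfolding \<zeta>_def
  by (intro continuous_on_compose2[OF \<theta>_cont] continuous_on_subset[OF continuous_on_product_coordinates])
    (use inverse_limit_mem in auto)

lemma dev_inverse_limit:
  assumes x: "x \<in> inverse_limit {-1..1} f" "x' \<in> inverse_limit {-1..1} f" and i: "i \<le> n"
  shows "\<bar>x i - x' i\<bar> \<le> dev n (\<zeta> d n x, \<zeta> d n x')"
proof -
  have "\<bar>pull (n - i) n (x n) - pull (n - i) n (x' n)\<bar> \<le> (\<Sum>k\<le>n. \<bar>pull k n (x n) - pull k n (x' n)\<bar>)"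
    by (rule member_le_sum) auto
  then show ?thesis using x i by (simp add: dev_def q_\<zeta> pull_inverse_limit)
qed

lemma stage_separates:
  assumes "stage j n \<Phi> e"
  shows "u \<in> {-1..1} \<Longrightarrow> v \<in> {-1..1} \<Longrightarrow> dist (\<Phi> (u, 0)) (\<Phi> (v, 0)) \<le> 4 * e \<Longrightarrow> dev n (u, v) < 1 / real (Suc j)"
    "u \<in> {-1..1} \<Longrightarrow> s \<in> {0..1} \<Longrightarrow> dist (\<Phi> (u, 0)) (0, - s) \<le> 4 * e \<Longrightarrow> s < 1 / real (Suc j)"
  using assms unfolding stage_def by (elim conjE, simp del: atLeastAtMost_iff)+

lemma limit_map_ex:
  "\<exists>\<Omega> :: (nat \<Rightarrow> real) \<Rightarrow> real \<times> real. continuous_on (inverse_limit {-1..1} f) \<Omega> \<and>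
     inj_on \<Omega> (inverse_limit {-1..1} f) \<and> \<Omega> (\<lambda>_. 0) = (0, 0) \<and>
     (\<forall>x\<in>inverse_limit {-1..1} f. \<forall>s\<in>{0<..1}. \<Omega> x \<noteq> (0, - s))"
proof -
  define X where "X = inverse_limit {-1..1} f"
  obtain N \<Phi> e d where st: "\<And>j. stage j (N j) (\<Phi> j) (e j)" and N: "\<And>j. N (Suc j) = Suc (N j + d j)"
    and half: "\<And>j. e (Suc j) \<le> e j / 2"
    and near: "\<And>j x. x \<in> {-1..1} \<Longrightarrow> dist (\<Phi> (Suc j) (x, 0)) (\<Phi> j (g (d j) (N j) x, 0)) \<le> e j"
  proof -
    obtain N \<Phi> e d where *: "\<forall>j. stage j (N j) (\<Phi> j) (e j) \<and> N (Suc j) = Suc (N j + d j) \<and> e (Suc j) \<le> e j / 2 \<and>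
      (\<forall>x\<in>{-1..1}. dist (\<Phi> (Suc j) (x, 0)) (\<Phi> j (g (d j) (N j) x, 0)) \<le> e j)"
      using stages_ex by (elim exE)
    show thesis by (rule that[of N \<Phi> e d]) (use * in auto)
  qed
  define a where "a = (\<lambda>j x. \<Phi> j (\<zeta> (d j) (N j) x, 0))"
  have e0: "0 < e j" for j using st[of j] by (simp add: stage_def)
  have step: "dist (a (Suc j) x) (a j x) \<le> e j" if x: "x \<in> X" for j x
    using near[OF \<zeta>_range[OF x[unfolded X_def]], of j "d (Suc j)" "N (Suc j)"] g_\<zeta>[OF x[unfolded X_def]]
    unfolding a_def N by simp
  \<comment> \<open>Halving gives
    \<open>e (j + i) \<le> 2 * e (j + i) - 2 * e (Suc (j + i))\<close>, so the steps telescope; the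
    subtracted term lets the induction close.\<close>
  have tele: "dist (a (j + i) x) (a j x) \<le> 2 * e j - 2 * e (j + i)" if x: "x \<in> X" for j i x
  proof (induction i)
    case (Suc i)
    have "dist (a (j + Suc i) x) (a j x) \<le> dist (a (Suc (j + i)) x) (a (j + i) x) + dist (a (j + i) x) (a j x)"
      by (simp add: dist_triangle)
    then show ?case using step[OF x, of "j + i"] Suc half[of "j + i"] by simp
  qed simp
  have tail: "dist (a k x) (a j x) \<le> 2 * e j" if x: "x \<in> X" and jk: "j \<le> k" for j k x
    using tele[OF x, of j "k - j"] e0[of k] jk by simp
  have "e j \<le> e 0 * (1/2) ^ j" for j
  proof (induction j)
    case (Suc j)
    then show ?case using half[of j] by simp
  qed simp
  moreover have "(\<lambda>j. e 0 * (1/2) ^ j) \<longlonglongrightarrow> e 0 * 0" by (intro tendsto_intros) auto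
  ultimately have elim: "e \<longlonglongrightarrow> 0"
    by (intro tendsto_sandwich[of "\<lambda>_. 0" e sequentially "\<lambda>j. e 0 * (1/2) ^ j"])
      (auto intro!: always_eventually less_imp_le[OF e0])
  have small: "\<exists>M. \<forall>j\<ge>M. 2 * e j < r" if "0 < r" for r
    using order_tendstoD(2)[OF elim, of "r / 2"] that unfolding eventually_sequentially by (auto simp: field_simps)
  define \<Omega> where "\<Omega> = (\<lambda>x. lim (\<lambda>j. a j x))"
  have conv: "(\<lambda>j. a j x) \<longlonglongrightarrow> \<Omega> x" if x: "x \<in> X" for x
  proof -
    have "Cauchy (\<lambda>j. a j x)"
    proof (rule metric_CauchyI)
      fix r :: real assume r: "0 < r"
      then obtain M where M: "\<forall>j\<ge>M. 2 * e j < r / 2" using small[of "r / 2"] by auto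
      have "dist (a m x) (a n x) < r" if "m \<ge> M" "n \<ge> M" for m n
        using dist_triangle2[of "a m x" "a n x" "a M x"] tail[OF x that(1)] tail[OF x that(2)] M[rule_format, of M]
        by linarith
      then show "\<exists>M. \<forall>m\<ge>M. \<forall>n\<ge>M. dist (a m x) (a n x) < r" by blast
    qed
    then show ?thesis unfolding \<Omega>_def by (simp add: Cauchy_convergent_iff convergent_LIMSEQ_iff)
  qed
  have lim: "dist (\<Omega> x) (a j x) \<le> 2 * e j" if x: "x \<in> X" for x j
    using tendsto_dist[OF conv[OF x] tendsto_const[of "a j x"]] tail[OF x, of j]
    by (intro LIMSEQ_le_const2) auto
  have contX: "continuous_on X \<Omega>"
  proof (rule uniform_limit_theorem)
    show "\<forall>\<^sub>F j in sequentially. continuous_on X (a j)"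
    proof (intro always_eventually allI)
      fix j
      have "continuous_on UNIV (\<Phi> j)" using st[of j] by (simp add: stage_def)
      moreover have "continuous_on X (\<lambda>x. (\<zeta> (d j) (N j) x, 0::real))"
        unfolding X_def by (intro continuous_on_Pair \<zeta>_cont continuous_on_const)
      ultimately show "continuous_on X (a j)"
        unfolding a_def by (rule continuous_on_compose2) simp
    qed
    show "uniform_limit X a \<Omega> sequentially"
    proof (rule uniform_limitI)
      fix r :: real assume "0 < r"
      then obtain M where M: "\<forall>j\<ge>M. 2 * e j < r" using small by blast
      have "dist (a j x) (\<Omega> x) < r" if "M \<le> j" "x \<in> X" for j x
        using lim[OF that(2), of j] M[rule_format, OF that(1)] by (simp add: dist_commute)
      then show "\<forall>\<^sub>F j in sequentially. \<forall>x\<in>X. dist (a j x) (\<Omega> x) < r"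
        unfolding eventually_sequentially by blast
    qed
  qed simp
  have tiny: "c \<le> 0" if "\<And>j. m \<le> j \<Longrightarrow> c < 1 / real (Suc j)" for c :: real and m
  proof (rule ccontr)
    assume "\<not> c \<le> 0"
    then obtain j where j: "1 / real (Suc j) < c" by (metis nat_approx_posE not_le)
    have "1 / real (Suc (max m j)) \<le> 1 / real (Suc j)" by (simp add: frac_le)
    then show False using that[of "max m j"] j by simp
  qed
  have "inj_on \<Omega> X"
  proof (rule inj_onI)
    fix x x' assume x: "x \<in> X" "x' \<in> X" and eq: "\<Omega> x = \<Omega> x'"
    have "\<bar>x i - x' i\<bar> < 1 / real (Suc j)" if "i \<le> j" for i j
    proof -
      \<comment> \<open>Each of the two points is within \<open>2 * e j\<close> of the common limit;
        this is the origin of the \<open>4 * e\<close> in \<open>stage\<close>.\<close>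
      have "dist (a j x) (a j x') \<le> 4 * e j"
        using dist_triangle3[of "a j x" "a j x'" "\<Omega> x"] lim[OF x(1), of j] lim[OF x(2), of j] eq by simp
      then have "dev (N j) (\<zeta> (d j) (N j) x, \<zeta> (d j) (N j) x') < 1 / real (Suc j)"
        unfolding a_def using x by (intro stage_separates(1)[OF st] \<zeta>_range) (simp_all add: X_def)
      moreover have "i \<le> N j" using st[of j] that by (simp add: stage_def)
      ultimately show ?thesis using dev_inverse_limit[of x x' i "N j" "d j"] x by (simp add: X_def)
    qed
    then have "\<bar>x i - x' i\<bar> \<le> 0" for i by (rule tiny)
    then show "x = x'" by (simp add: fun_eq_iff)
  qed
  moreover have "\<Omega> x \<noteq> (0, - s)" if x: "x \<in> X" and s: "s \<in> {0<..1}" for x s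
  proof
    assume eq: "\<Omega> x = (0, - s)"
    have "s < 1 / real (Suc j)" for j
    proof -
      have "dist (a j x) (0, - s) \<le> 4 * e j" using lim[OF x, of j] e0[of j] eq by (simp add: dist_commute)
      then show ?thesis
        unfolding a_def using x s by (intro stage_separates(2)[OF st \<zeta>_range]) (simp_all add: X_def)
    qed
    then have "s \<le> 0" by (rule tiny)
    then show False using s by simp
  qed
  moreover have "\<Omega> (\<lambda>_. 0) = (0, 0)"
  proof -
    have "a j (\<lambda>_. 0) = (0, 0)" for j
    proof -
      have "\<Phi> j (0, - 0) = (0, - 0)" using st[of j] unfolding stage_def by blast
      then show ?thesis by (simp add: a_def \<zeta>_def \<theta>_0)
    qed
    then show ?thesis by (simp add: \<Omega>_def)
  qed
  ultimately show ?thesis using contX unfolding X_def by blast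
qed

end

section \<open>From the hypotheses to a folded system, and transfer to the plane\<close>

text \<open>\<open>M n\<close> lifts through the fold of level \<open>n\<close> a map that involves
  the fold of level \<open>Suc n\<close>, so all \<open>T\<close> and \<open>S\<close> are fixed
  before any \<open>M\<close>.\<close>

lemma folded_ex:
  fixes f :: "nat \<Rightarrow> real \<Rightarrow> real"
  assumes "\<And>n. folding_data (f n) (f (Suc n))"
  shows "\<exists>T S M. folded f T S M"
proof -
  define T where "T = (\<lambda>n. contour_factor (f n \<circ> uminus))"
  have T: "continuous_on {0..1} (T n)" "T n \<in> {0..1} \<rightarrow> {-1..1}" "T n 0 = 0" for n
    using folding_data.fold_f(1-3)[OF assms, of n] by (auto simp: T_def)
  have "\<exists>S. continuous_on {0..1} S \<and> S \<in> {0..1} \<rightarrow> {0..1} \<and> S 0 = 0 \<and> 1 \<in> S ` {0..1} \<and>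
    (\<forall>x\<in>{0..1}. T n (S x) = f n (- x))" for n
    using folding_data.fold_f(4)[OF assms] by (simp add: T_def)
  then obtain S where S: "\<And>n. continuous_on {0..1} (S n)" "\<And>n. S n \<in> {0..1} \<rightarrow> {0..1}" "\<And>n. S n 0 = 0"
    "\<And>n. 1 \<in> S n ` {0..1}" "\<And>n x. x \<in> {0..1} \<Longrightarrow> T n (S n x) = f n (- x)"
    by metis
  have "\<exists>M. continuous_on {0..1} M \<and> M \<in> {0..1} \<rightarrow> {0..1} \<and> M 0 = 0 \<and>
    (\<forall>y\<in>{0..1}. T n (M y) = f n (T (Suc n) y))" for n
    using folding_data.fold_fg[OF assms[of n] T(1-3)[of "Suc n"] S(1-4)[of "Suc n"] S(5)[of _ "Suc n"]]
    by (simp only: T_def)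
  then obtain M where M: "\<And>n. continuous_on {0..1} (M n)" "\<And>n. M n \<in> {0..1} \<rightarrow> {0..1}" "\<And>n. M n 0 = 0"
    "\<And>n y. y \<in> {0..1} \<Longrightarrow> T n (M n y) = f n (T (Suc n) y)"
    by metis
  have "folded f T S M"
  proof
    show "continuous_on {-1..1} (f n)" "f n \<in> {-1..1} \<rightarrow> {-1..1}" "f n 0 = 0" for n
      using folding_data.cf[OF assms] folding_data.rf[OF assms] folding_data.f0[OF assms] by auto
  qed (use T S M in auto)
  then show ?thesis by blast
qed

theorem theorem4p2:
  fixes f :: "nat \<Rightarrow> real \<Rightarrow> real"
  assumes "\<And>n. f n \<in> {-1..1} \<rightarrow> {-1..1}"
    and "\<And>n. piecewise_linear_on (-1) 1 (f n)"
    and "\<And>n. f n 0 = 0"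
    and "\<And>n. \<not> f n constant_on {-1..0}"
    and "\<And>n. \<not> f n constant_on {0..1}"
    and "\<And>n. \<not> (f n \<circ> f (Suc n)) constant_on {-1..0}"
    and "\<And>n. \<not> (f n \<circ> f (Suc n)) constant_on {0..1}"
    and "\<And>n x. x \<in> {-1..1} \<Longrightarrow>
           radial_contour_factor (f n) x = radial_contour_factor (f n \<circ> f (Suc n)) x"
  shows "\<exists>\<Omega> :: (nat \<Rightarrow> real) \<Rightarrow> real ^ 2.
           embedding_map (top_of_set (inverse_limit {-1..1} f)) euclidean \<Omega> \<and>
           accessible (inverse_limit {-1..1} f) \<Omega> (\<lambda>n. 0)"
proof -
  define X where "X = inverse_limit {-1..1} f"
  have "folding_data (f n) (f (Suc n))" for n
  proof
    show "contour_factor (f n \<circ> uminus) y = contour_factor (f n \<circ> f (Suc n) \<circ> uminus) y"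
      if "0 < y" "y \<le> 1" for y
      using assms(8)[of "- y" n] that by (simp add: radial_contour_factor_def)
  qed (use assms in auto)
  then obtain T S M where "folded f T S M" using folded_ex by blast
  then interpret folded f T S M .
  obtain \<Omega> :: "(nat \<Rightarrow> real) \<Rightarrow> real \<times> real" where \<Omega>: "continuous_on X \<Omega>" "inj_on \<Omega> X" "\<Omega> (\<lambda>_. 0) = (0, 0)"
    "\<And>x s. x \<in> X \<Longrightarrow> s \<in> {0<..1} \<Longrightarrow> \<Omega> x \<noteq> (0, - s)"
    using limit_map_ex unfolding X_def by blast
  define \<psi> :: "real \<times> real \<Rightarrow> real ^ 2" where "\<psi> = (\<lambda>p. \<chi> i. if i = 1 then fst p else snd p)"
  have inj: "inj \<psi>"
  proof (rule injI)
    fix p p' assume "\<psi> p = \<psi> p'"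
    then have "\<psi> p $ 1 = \<psi> p' $ 1" "\<psi> p $ 2 = \<psi> p' $ 2" by auto
    then show "p = p'" by (simp add: \<psi>_def prod_eq_iff)
  qed
  have cont: "continuous_on A \<psi>" for A
    unfolding \<psi>_def
  proof (intro continuous_on_vec_lambda)
    show "continuous_on A (\<lambda>p. if i = 1 then fst p else snd p)" for i :: 2
      by (cases "i = 1") (auto intro!: continuous_intros)
  qed
  have X0: "(\<lambda>_. 0) \<in> X" using assms(3) by (simp add: X_def inverse_limit_def)
  have "embedding_map (top_of_set X) euclidean (\<psi> \<circ> \<Omega>)"
  proof (rule continuous_imp_embedding_map)
    show "continuous_map (top_of_set X) euclidean (\<psi> \<circ> \<Omega>)"
      unfolding continuous_map_iff_continuous by (intro continuous_on_compose \<Omega>(1) cont)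
    show "compact_space (top_of_set X)"
      unfolding X_def by (intro compact_space_subtopology) (simp add: compact_inverse_limit f_cont)
    show "inj_on (\<psi> \<circ> \<Omega>) (topspace (top_of_set X))"
      using \<Omega>(2) inj by (simp add: comp_inj_on inj_on_subset)
  qed simp
  moreover have "accessible X (\<psi> \<circ> \<Omega>) (\<lambda>n. 0)"
  proof -
    define A where "A = (\<lambda>t. \<psi> (0, - t)) ` {0..1}"
    have "{0..1::real} homeomorphic A"
    proof (rule homeomorphic_compact)
      show "continuous_on {0..1} (\<lambda>t. \<psi> (0, - t))"
        by (intro continuous_on_compose2[OF cont[of UNIV]] continuous_intros) simp
      show "inj_on (\<lambda>t. \<psi> (0, - t)) {0..1}" by (intro inj_onI) (auto dest: injD[OF inj])
    qed (simp_all add: A_def)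
    moreover have "A \<inter> (\<psi> \<circ> \<Omega>) ` X = {(\<psi> \<circ> \<Omega>) (\<lambda>n. 0)}"
    proof
      show "A \<inter> (\<psi> \<circ> \<Omega>) ` X \<subseteq> {(\<psi> \<circ> \<Omega>) (\<lambda>n. 0)}"
      proof
        fix p assume "p \<in> A \<inter> (\<psi> \<circ> \<Omega>) ` X"
        then obtain t x where t: "t \<in> {0..1}" "p = \<psi> (0, - t)" and x: "x \<in> X" "p = \<psi> (\<Omega> x)"
          unfolding A_def by auto
        then have "\<Omega> x = (0, - t)" using injD[OF inj] by metis
        then have "t = 0" using \<Omega>(4)[OF x(1), of t] t by (auto simp: less_le)
        then show "p \<in> {(\<psi> \<circ> \<Omega>) (\<lambda>n. 0)}" using t \<Omega>(3) by simp
      qed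
      have "(\<psi> \<circ> \<Omega>) (\<lambda>n. 0) \<in> A" unfolding A_def using \<Omega>(3) by (intro image_eqI[of _ _ 0]) auto
      then show "{(\<psi> \<circ> \<Omega>) (\<lambda>n. 0)} \<subseteq> A \<inter> (\<psi> \<circ> \<Omega>) ` X" using imageI[OF X0] by blast
    qed
    ultimately show ?thesis unfolding accessible_def using X0 homeomorphic_sym by blast
  qed
  ultimately show ?thesis unfolding X_def by blast
qed

end
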